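(* Let $k$ be a natural number and let $\varphi$ be a formula of $\mathsf{HA}$ (possibly containing free variables) which does not contain $\lor$. (1) If $\varphi \in \mathrm{E}_k^+$, then there exists $\varphi'\in\Sigma_k$ with $\mathrm{FV}(\varphi)=\mathrm{FV}(\varphi')$ and $\mathsf{HA}+\mathrm{DNE}(\Sigma_k)\vdash\varphi\leftrightarrow\varphi'$. (2) If $\varphi\in\mathrm{U}_k^+$, then there exists $\varphi'\in\Pi_k$ with $\mathrm{FV}(\varphi)=\mathrm{FV}(\varphi')$ and $\mathsf{HA}+\mathrm{DNE}(\Sigma_{k-1})\vdash\varphi\leftrightarrow\varphi'$ (for $k=0$: $\mathsf{HA}\vdash\varphi\leftrightarrow\varphi'$).
   Context: $\mathsf{HA}$ is intuitionistic (Heyting) arithmetic in the language with function symbols for all primitive recursive functions and logical constants $\forall,\exists,\to,\land,\lor,\perp$; $\neg\varphi$ abbreviates $\varphi\to\perp$. For a theory $T$ and schema $\mathrm{P}$, $T+\mathrm{P}$ adds all instances of $\mathrm{P}$ as axioms. $\mathrm{FV}(\varphi)$ is the set of free variables of $\varphi$. $\Sigma_0=\Pi_0$ is the class of quantifier-free formulas; $\Pi_{k+1}$ consists of formulas $Q_1\bar x_1\cdots Q_{k+1}\bar x_{k+1}\,\varphi_{qf}$ ($\varphi_{qf}$ quantifier-free, $Q_i=\forall$ for odd $i$, $\exists$ for even $i$), $\Sigma_{k+1}$ likewise starting with $\exists$ (by the paper's convention blocks may be empty). $\Gamma(\bar x)$ is the set of formulas in $\Gamma$ with free variables among $\bar x$.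 $\mathrm{DNE}(\Gamma)$ is the schema $\forall x(\neg\neg\varphi(x)\to\varphi(x))$ for $\varphi(x)\in\Gamma(x)$. Alternation paths: finite sequences of $+,-$ that alternate; $i(s)$ is the first symbol ($\times$ if empty), $s^\perp$ swaps $+$ and $-$, $l(s)$ is the length. $\mathrm{Alt}(\varphi)$: $\{\langle\rangle\}$ if $\varphi$ is quantifier-free; otherwise $\mathrm{Alt}(\neg\varphi_1)=\{s^\perp:s\in\mathrm{Alt}(\varphi_1)\}$; $\mathrm{Alt}(\varphi_1\land\varphi_2)=\mathrm{Alt}(\varphi_1\lor\varphi_2)=\mathrm{Alt}(\varphi_1)\cup\mathrm{Alt}(\varphi_2)$; $\mathrm{Alt}(\varphi_1\to\varphi_2)=\{s^\perp:s\in\mathrm{Alt}(\varphi_1)\}\cup\mathrm{Alt}(\varphi_2)$; $\mathrm{Alt}(\forall x\varphi_1)=\{s\in\mathrm{Alt}(\varphi_1):i(s)=-\}\cup\{-s:s\in\mathrm{Alt}(\varphi_1),i(s)\ne-\}$; $\mathrm{Alt}(\exists x\varphi_1)=\{s\in\mathrm{Alt}(\varphi_1):i(s)=+\}\cup\{+s:s\in\mathrm{Alt}(\varphi_1),i(s)\ne+\}$. $\deg(\varphi)=\max\{l(s):s\in\mathrm{Alt}(\varphi)\}$; $\mathrm{F}_k=\{\varphi:\deg\varphi=k\}$; $\mathrm{U}_0=\mathrm{E}_0=\mathrm{F}_0$; $\mathrm{U}_{k+1}=\{\varphi\in\mathrm{F}_{k+1}:i(s)=-$ for all $s\in\mathrm{Alt}(\varphi)$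 with $l(s)=k+1\}$; $\mathrm{E}_{k+1}$ likewise with $+$; $\mathrm{U}_k^+=\mathrm{U}_k\cup\bigcup_{i<k}\mathrm{F}_i$, $\mathrm{E}_k^+=\mathrm{E}_k\cup\bigcup_{i<k}\mathrm{F}_i$. *)

theory Defs
  imports Main
begin

section \<open>The language of arithmetic\<close>

text \<open>Function symbols are the definitions of primitive recursive functions. \<open>Comp n f gs\<close> carries
  its arity \<open>n\<close>, because \<open>gs\<close> may be empty; in \<open>Rec f g\<close> the recursion argument comes first.\<close>

datatype sym = Zero | Succ | Proj nat nat | Comp nat sym "sym list" | Rec sym sym

fun arity :: "sym \<Rightarrow> nat" where
  "arity Zero = 0"
| "arity Succ = 1"
| "arity (Proj n i) = n"
| "arity (Comp n f gs) = n"
| "arity (Rec f g) = arity f + 1"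

fun wf_sym :: "sym \<Rightarrow> bool" where
  "wf_sym Zero = True"
| "wf_sym Succ = True"
| "wf_sym (Proj n i) = (i < n)"
| "wf_sym (Comp n f gs) =
     (wf_sym f \<and> arity f = length gs \<and> (\<forall>g \<in> set gs. wf_sym g \<and> arity g = n))"
| "wf_sym (Rec f g) = (wf_sym f \<and> wf_sym g \<and> arity g = arity f + 2)"

datatype trm = Var nat | Fn sym "trm list"

fun wf_trm :: "trm \<Rightarrow> bool" where
  "wf_trm (Var n) = True"
| "wf_trm (Fn f ts) = (wf_sym f \<and> length ts = arity f \<and> (\<forall>t \<in> set ts. wf_trm t))"

fun fv_trm :: "trm \<Rightarrow> nat set" where
  "fv_trm (Var n) = {n}"
| "fv_trm (Fn f ts) = (\<Union>t \<in> set ts. fv_trm t)"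

abbreviation zero :: trm where "zero \<equiv> Fn Zero []"

abbreviation succ :: "trm \<Rightarrow> trm" where "succ t \<equiv> Fn Succ [t]"

text \<open>Formulas with de Bruijn indices: \<open>All\<close> and \<open>Ex\<close> bind the variable \<open>0\<close> of their body.\<close>

datatype fm =
    Eq trm trm
  | Fls
  | And fm fm
  | Or fm fm
  | Imp fm fm
  | All fm
  | Ex fm

abbreviation Neg :: "fm \<Rightarrow> fm" where "Neg p \<equiv> Imp p Fls"

abbreviation Iff :: "fm \<Rightarrow> fm \<Rightarrow> fm" where "Iff p q \<equiv> And (Imp p q) (Imp q p)"

primrec wf_fm :: "fm \<Rightarrow> bool" where
  "wf_fm (Eq s t) = (wf_trm s \<and> wf_trm t)"
| "wf_fm Fls = True"
| "wf_fm (And p q) = (wf_fm p \<and> wf_fm q)"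
| "wf_fm (Or p q) = (wf_fm p \<and> wf_fm q)"
| "wf_fm (Imp p q) = (wf_fm p \<and> wf_fm q)"
| "wf_fm (All p) = wf_fm p"
| "wf_fm (Ex p) = wf_fm p"

primrec fv :: "fm \<Rightarrow> nat set" where
  "fv (Eq s t) = fv_trm s \<union> fv_trm t"
| "fv Fls = {}"
| "fv (And p q) = fv p \<union> fv q"
| "fv (Or p q) = fv p \<union> fv q"
| "fv (Imp p q) = fv p \<union> fv q"
| "fv (All p) = {n. Suc n \<in> fv p}"
| "fv (Ex p) = {n. Suc n \<in> fv p}"

primrec has_disj :: "fm \<Rightarrow> bool" where
  "has_disj (Eq s t) = False"
| "has_disj Fls = False"
| "has_disj (And p q) = (has_disj p \<or> has_disj q)"
| "has_disj (Or p q) = True"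
| "has_disj (Imp p q) = (has_disj p \<or> has_disj q)"
| "has_disj (All p) = has_disj p"
| "has_disj (Ex p) = has_disj p"

primrec qfree :: "fm \<Rightarrow> bool" where
  "qfree (Eq s t) = True"
| "qfree Fls = True"
| "qfree (And p q) = (qfree p \<and> qfree q)"
| "qfree (Or p q) = (qfree p \<and> qfree q)"
| "qfree (Imp p q) = (qfree p \<and> qfree q)"
| "qfree (All p) = False"
| "qfree (Ex p) = False"

subsection \<open>Parallel substitution\<close>

fun subst_trm :: "(nat \<Rightarrow> trm) \<Rightarrow> trm \<Rightarrow> trm" where
  "subst_trm \<sigma> (Var n) = \<sigma> n"
| "subst_trm \<sigma> (Fn f ts) = Fn f (map (subst_trm \<sigma>) ts)"

definition under :: "(nat \<Rightarrow> trm) \<Rightarrow> nat \<Rightarrow> trm" where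
  "under \<sigma> = case_nat (Var 0) (\<lambda>n. subst_trm (\<lambda>m. Var (Suc m)) (\<sigma> n))"

primrec subst :: "(nat \<Rightarrow> trm) \<Rightarrow> fm \<Rightarrow> fm" where
  "subst \<sigma> (Eq s t) = Eq (subst_trm \<sigma> s) (subst_trm \<sigma> t)"
| "subst \<sigma> Fls = Fls"
| "subst \<sigma> (And p q) = And (subst \<sigma> p) (subst \<sigma> q)"
| "subst \<sigma> (Or p q) = Or (subst \<sigma> p) (subst \<sigma> q)"
| "subst \<sigma> (Imp p q) = Imp (subst \<sigma> p) (subst \<sigma> q)"
| "subst \<sigma> (All p) = All (subst (under \<sigma>) p)"
| "subst \<sigma> (Ex p) = Ex (subst (under \<sigma>) p)"

definition lift :: "fm \<Rightarrow> fm" where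
  "lift = subst (\<lambda>n. Var (Suc n))"

text \<open>\<open>inst p t\<close> is the result of removing the quantifier of \<open>All p\<close> or \<open>Ex p\<close> and putting \<open>t\<close> for
  its variable.\<close>

definition inst :: "fm \<Rightarrow> trm \<Rightarrow> fm" where
  "inst p t = subst (case_nat t Var) p"


section \<open>Heyting arithmetic\<close>

text \<open>Intuitionistic natural deduction from a set \<open>T\<close> of axioms and a set \<open>G\<close> of open hypotheses.
  The eigenvariable of \<open>AllI\<close> and \<open>ExE\<close> is the variable \<open>0\<close>, made fresh by lifting \<open>G\<close>. Axioms are
  not lifted, so that an axiom with free variables stands for its universal closure.\<close>

inductive deriv :: "fm set \<Rightarrow> fm set \<Rightarrow> fm \<Rightarrow> bool" for T :: "fm set" where
  Ax: "p \<in> T \<Longrightarrow> deriv T G p"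
| Hyp: "p \<in> G \<Longrightarrow> wf_fm p \<Longrightarrow> deriv T G p"
| FlsE: "deriv T G Fls \<Longrightarrow> wf_fm p \<Longrightarrow> deriv T G p"
| AndI: "deriv T G p \<Longrightarrow> deriv T G q \<Longrightarrow> deriv T G (And p q)"
| AndE1: "deriv T G (And p q) \<Longrightarrow> deriv T G p"
| AndE2: "deriv T G (And p q) \<Longrightarrow> deriv T G q"
| OrI1: "deriv T G p \<Longrightarrow> wf_fm q \<Longrightarrow> deriv T G (Or p q)"
| OrI2: "deriv T G q \<Longrightarrow> wf_fm p \<Longrightarrow> deriv T G (Or p q)"
| OrE: "deriv T G (Or p q) \<Longrightarrow> deriv T (insert p G) r \<Longrightarrow> deriv T (insert q G) r \<Longrightarrow> deriv T G r"
| ImpI: "deriv T (insert p G) q \<Longrightarrow> wf_fm p \<Longrightarrow> deriv T G (Imp p q)"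
| ImpE: "deriv T G (Imp p q) \<Longrightarrow> deriv T G p \<Longrightarrow> deriv T G q"
| AllI: "deriv T (lift ` G) p \<Longrightarrow> deriv T G (All p)"
| AllE: "deriv T G (All p) \<Longrightarrow> wf_trm t \<Longrightarrow> deriv T G (inst p t)"
| ExI: "deriv T G (inst p t) \<Longrightarrow> wf_trm t \<Longrightarrow> deriv T G (Ex p)"
| ExE: "deriv T G (Ex p) \<Longrightarrow> deriv T (insert p (lift ` G)) (lift q) \<Longrightarrow> deriv T G q"

abbreviation provable :: "fm set \<Rightarrow> fm \<Rightarrow> bool" (infix \<open>\<turnstile>\<close> 50) where
  "T \<turnstile> p \<equiv> deriv T {} p"

text \<open>In \<open>induction\<close> the second substitution puts the successor of variable \<open>0\<close> for variable \<open>0\<close> and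
  keeps all other variables.\<close>

inductive_set HA :: "fm set" where
  eq_refl: "wf_trm t \<Longrightarrow> Eq t t \<in> HA"
| eq_subst: "wf_trm s \<Longrightarrow> wf_trm t \<Longrightarrow> wf_fm p \<Longrightarrow> Imp (Eq s t) (Imp (inst p s) (inst p t)) \<in> HA"
| succ_nonzero: "wf_trm t \<Longrightarrow> Neg (Eq (succ t) zero) \<in> HA"
| succ_inj: "wf_trm s \<Longrightarrow> wf_trm t \<Longrightarrow> Imp (Eq (succ s) (succ t)) (Eq s t) \<in> HA"
| proj: "wf_trm (Fn (Proj n i) ts) \<Longrightarrow> Eq (Fn (Proj n i) ts) (ts ! i) \<in> HA"
| comp: "wf_trm (Fn (Comp n f gs) ts) \<Longrightarrow>
    Eq (Fn (Comp n f gs) ts) (Fn f (map (\<lambda>g. Fn g ts) gs)) \<in> HA"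
| rec_zero: "wf_trm (Fn (Rec f g) (zero # ts)) \<Longrightarrow>
    Eq (Fn (Rec f g) (zero # ts)) (Fn f ts) \<in> HA"
| rec_succ: "wf_trm (Fn (Rec f g) (succ t # ts)) \<Longrightarrow>
    Eq (Fn (Rec f g) (succ t # ts)) (Fn g (t # Fn (Rec f g) (t # ts) # ts)) \<in> HA"
| induction: "wf_fm p \<Longrightarrow>
    Imp (And (inst p zero)
             (All (Imp p (subst (case_nat (succ (Var 0)) (\<lambda>n. Var (Suc n))) p))))
        (All p) \<in> HA"


section \<open>Prenex classes and double negation elimination\<close>

fun Sigma_fm :: "nat \<Rightarrow> fm set" and Pi_fm :: "nat \<Rightarrow> fm set" where
  "Sigma_fm 0 = {p. wf_fm p \<and> qfree p}"
| "Sigma_fm (Suc k) = {(Ex ^^ n) p | n p. p \<in> Pi_fm k}"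
| "Pi_fm 0 = {p. wf_fm p \<and> qfree p}"
| "Pi_fm (Suc k) = {(All ^^ n) p | n p. p \<in> Sigma_fm k}"

definition DNE :: "fm set \<Rightarrow> fm set" where
  "DNE \<Gamma> = {All (Imp (Neg (Neg p)) p) | p. p \<in> \<Gamma> \<and> fv p \<subseteq> {0}}"


section \<open>Alternation paths\<close>

datatype sign = Plus | Minus

type_synonym path = "sign list"

fun opposite :: "sign \<Rightarrow> sign" where
  "opposite Plus = Minus"
| "opposite Minus = Plus"

definition flip :: "path \<Rightarrow> path" where
  "flip = map opposite"

text \<open>\<open>None\<close> is the value for the empty path.\<close>

definition initial :: "path \<Rightarrow> sign option" where
  "initial s = (case s of [] \<Rightarrow> None | c # _ \<Rightarrow> Some c)"

definition prefix_sign :: "sign \<Rightarrow> path set \<Rightarrow> path set" where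
  "prefix_sign c A = {s \<in> A. initial s = Some c} \<union> {c # s | s. s \<in> A \<and> initial s \<noteq> Some c}"

text \<open>Negation has its own clause: \<open>Neg p\<close> does not receive the empty path that \<open>Fls\<close> would
  contribute under the clause for implication.\<close>

primrec Alt :: "fm \<Rightarrow> path set" where
  "Alt (Eq s t) = {[]}"
| "Alt Fls = {[]}"
| "Alt (And p q) = (if qfree (And p q) then {[]} else Alt p \<union> Alt q)"
| "Alt (Or p q) = (if qfree (Or p q) then {[]} else Alt p \<union> Alt q)"
| "Alt (Imp p q) =
     (if qfree (Imp p q) then {[]}
      else if q = Fls then flip ` Alt p
      else flip ` Alt p \<union> Alt q)"
| "Alt (All p) = prefix_sign Minus (Alt p)"
| "Alt (Ex p) = prefix_sign Plus (Alt p)"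

definition degree :: "fm \<Rightarrow> nat" where
  "degree p = Max (length ` Alt p)"

definition F_class :: "nat \<Rightarrow> fm set" where
  "F_class k = {p. wf_fm p \<and> degree p = k}"

fun U_class :: "nat \<Rightarrow> fm set" where
  "U_class 0 = F_class 0"
| "U_class (Suc k) =
     {p \<in> F_class (Suc k). \<forall>s \<in> Alt p. length s = Suc k \<longrightarrow> initial s = Some Minus}"

fun E_class :: "nat \<Rightarrow> fm set" where
  "E_class 0 = F_class 0"
| "E_class (Suc k) =
     {p \<in> F_class (Suc k). \<forall>s \<in> Alt p. length s = Suc k \<longrightarrow> initial s = Some Plus}"

definition U_plus :: "nat \<Rightarrow> fm set" where
  "U_plus k = U_class k \<union> (\<Union>i<k. F_class i)"

definition E_plus :: "nat \<Rightarrow> fm set" where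
  "E_plus k = E_class k \<union> (\<Union>i<k. F_class i)"

end

theory Submission imports Defs begin

text \<open>Write \<open>T\<^sub>k\<close> for \<open>HA + DNE(\<Sigma>\<^sub>k\<^sub>-\<^sub>1)\<close>. Induction on the formula, for all \<open>k\<close> at once, shows that a
  formula in \<open>U\<^sub>k\<^sup>+\<close> has a \<open>\<Pi>\<^sub>k\<close> form over \<open>T\<^sub>k\<close>, and that a formula \<open>\<phi>\<close> in \<open>E\<^sub>k\<^sup>+\<close> has a \<open>\<Sigma>\<^sub>k\<close> form \<open>\<phi>'\<close> over
  \<open>T\<^sub>k\<^sub>+\<^sub>1\<close> for which already \<open>T\<^sub>k\<close> proves \<open>\<not>\<phi> \<leftrightarrow> \<not>\<phi>'\<close>. The last clause handles an implication \<open>\<phi> \<rightarrow> \<psi>\<close> in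
  \<open>U\<^sub>k\<^sup>+\<close>: its conclusion is equivalent to a \<open>\<Pi>\<^sub>k\<close> formula, \<open>T\<^sub>k\<close> has double negation elimination for such
  formulas, and hence \<open>\<phi>\<close> matters only up to double negation. Quantifiers are pulled out of an
  implication into a \<open>\<Sigma>\<^sub>k\<close> form by a classical argument below a double negation. The schema \<open>DNE\<close>
  has a single parameter; several parameters are reduced to one by an injective pairing function.\<close>

section \<open>Substitution\<close>

text \<open>The invariant on negations survives the induction because \<not>(p \<and> q), \<not>(p
  \<rightarrow> q) and \<not>\<exists>x p depend, intuitionistically, only on the negations of their
  parts. The way round: a formula \<forall>x p in E_(k+1)^+ has no path of length k+1 at all, so it
  already lies in U_k^+, where full equivalence is at hand over a weaker theory. Disjunction is
  excluded for a related reason: \<Pi>_k formulas are stable over their theory, whereas stability of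
  a disjunction of two \<Pi>_1 formulas is a form of LLPO, unprovable in HA. Only injectivity is
  asked of the pairing function: decoding is left to existential quantifiers, which a \<Sigma>_(k+1)
  formula absorbs. The coding 2^x (2y+1) keeps the arithmetic to inductions about doubling.\<close>

lemma subst_trm_cong:
  "(\<And>n. n \<in> fv_trm t \<Longrightarrow> \<sigma> n = \<tau> n) \<Longrightarrow> subst_trm \<sigma> t = subst_trm \<tau> t"
  by (induction t) auto

lemma subst_trm_Var [simp]: "subst_trm Var t = t"
  by (induction t) (auto intro: map_idI)

lemma subst_trm_comp: "subst_trm \<sigma> (subst_trm \<tau> t) = subst_trm (\<lambda>n. subst_trm \<sigma> (\<tau> n)) t"
  by (induction t) auto

lemma under_simps [simp]:
  "under \<sigma> 0 = Var 0"
  "under \<sigma> (Suc n) = subst_trm (\<lambda>m. Var (Suc m)) (\<sigma> n)"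
  by (simp_all add: under_def)

lemma under_Var [simp]: "under Var = Var"
  by (rule ext) (simp add: under_def split: nat.split)

lemma under_comp: "(\<lambda>n. subst_trm (under \<sigma>) (under \<tau> n)) = under (\<lambda>n. subst_trm \<sigma> (\<tau> n))"
proof
  fix n show "subst_trm (under \<sigma>) (under \<tau> n) = under (\<lambda>n. subst_trm \<sigma> (\<tau> n)) n"
    by (cases n) (simp_all add: subst_trm_comp)
qed

lemma subst_cong: "(\<And>n. n \<in> fv p \<Longrightarrow> \<sigma> n = \<tau> n) \<Longrightarrow> subst \<sigma> p = subst \<tau> p"
proof (induction p arbitrary: \<sigma> \<tau>)
  case (Eq s t)
  then show ?case by (auto intro!: subst_trm_cong)
next
  case (All p)
  have "subst (under \<sigma>) p = subst (under \<tau>) p"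
  proof (rule All.IH)
    fix n assume "n \<in> fv p"
    then show "under \<sigma> n = under \<tau> n" using All.prems by (cases n) auto
  qed
  then show ?case by simp
next
  case (Ex p)
  have "subst (under \<sigma>) p = subst (under \<tau>) p"
  proof (rule Ex.IH)
    fix n assume "n \<in> fv p"
    then show "under \<sigma> n = under \<tau> n" using Ex.prems by (cases n) auto
  qed
  then show ?case by simp
next
  case (And p q) from And.IH[of \<sigma> \<tau>] And.prems show ?case by simp
next
  case (Or p q) from Or.IH[of \<sigma> \<tau>] Or.prems show ?case by simp
next
  case (Imp p q) from Imp.IH[of \<sigma> \<tau>] Imp.prems show ?case by simp
qed simp

lemma subst_Var [simp]: "subst Var p = p"
  by (induction p) simp_all

lemma subst_comp: "subst \<sigma> (subst \<tau> p) = subst (\<lambda>n. subst_trm \<sigma> (\<tau> n)) p"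
  by (induction p arbitrary: \<sigma> \<tau>) (simp_all add: subst_trm_comp under_comp)

lemma subst_ident: "(\<And>n. n \<in> fv p \<Longrightarrow> \<sigma> n = Var n) \<Longrightarrow> subst \<sigma> p = p"
  using subst_cong[of p \<sigma> Var] by simp

lemma subst_under_lift: "subst (under \<sigma>) (lift p) = lift (subst \<sigma> p)"
  by (simp add: lift_def subst_comp)

lemma inst_lift [simp]: "inst (lift p) t = p"
  by (simp add: inst_def lift_def subst_comp)

lemma subst_inst: "subst \<sigma> (inst p t) = inst (subst (under \<sigma>) p) (subst_trm \<sigma> t)"
  unfolding inst_def subst_comp
  by (rule arg_cong[where f = "\<lambda>\<sigma>. subst \<sigma> p"], rule ext)
     (auto simp: under_def subst_trm_comp split: nat.split)

lemma inst_subst_under: "inst (subst (under \<sigma>) p) t = subst (case_nat t \<sigma>) p"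
  unfolding inst_def subst_comp
  by (rule arg_cong[where f = "\<lambda>\<sigma>. subst \<sigma> p"], rule ext)
     (auto simp: under_def subst_trm_comp split: nat.split)

text \<open>With \<open>inst_subst_under\<close> this undoes a lifting below a binder: the lifted
  body, instantiated at variable 0, is the body itself. The passage between a quantified formula and
  its open body rests on it.\<close>

lemma case_nat_Var [simp]: "case_nat (Var 0) (\<lambda>n. Var (Suc n)) = Var"
  by (auto split: nat.split)

lemma lift_simps [simp]:
  "lift (Eq s t) = Eq (subst_trm (\<lambda>n. Var (Suc n)) s) (subst_trm (\<lambda>n. Var (Suc n)) t)"
  "lift Fls = Fls"
  "lift (And p q) = And (lift p) (lift q)"
  "lift (Or p q) = Or (lift p) (lift q)"
  "lift (Imp p q) = Imp (lift p) (lift q)"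
  "lift (All p) = All (subst (under (\<lambda>n. Var (Suc n))) p)"
  "lift (Ex p) = Ex (subst (under (\<lambda>n. Var (Suc n))) p)"
  by (simp_all add: lift_def)

lemma wf_subst_trm: "wf_trm t \<Longrightarrow> (\<And>n. wf_trm (\<sigma> n)) \<Longrightarrow> wf_trm (subst_trm \<sigma> t)"
  by (induction t) auto

lemma wf_under: "(\<And>n. wf_trm (\<sigma> n)) \<Longrightarrow> wf_trm (under \<sigma> n)"
  by (cases n) (simp_all add: wf_subst_trm)

lemma wf_subst: "wf_fm p \<Longrightarrow> (\<And>n. wf_trm (\<sigma> n)) \<Longrightarrow> wf_fm (subst \<sigma> p)"
  by (induction p arbitrary: \<sigma>) (simp_all add: wf_subst_trm wf_under)

lemma wf_lift [simp]: "wf_fm p \<Longrightarrow> wf_fm (lift p)"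
  by (simp add: lift_def wf_subst)

lemma fv_trm_subst: "fv_trm (subst_trm \<sigma> t) = (\<Union>n \<in> fv_trm t. fv_trm (\<sigma> n))"
  by (induction t) auto

lemma fv_under: "{m. Suc m \<in> (\<Union>n \<in> A. fv_trm (under \<sigma> n))} = (\<Union>n \<in> {n. Suc n \<in> A}. fv_trm (\<sigma> n))"
proof -
  have "(Suc m \<in> fv_trm (under \<sigma> n)) = (\<exists>n'. n = Suc n' \<and> m \<in> fv_trm (\<sigma> n'))" for m n
    by (cases n) (auto simp: fv_trm_subst)
  then show ?thesis by auto
qed

lemma fv_subst: "fv (subst \<sigma> p) = (\<Union>n \<in> fv p. fv_trm (\<sigma> n))"
proof (induction p arbitrary: \<sigma>)
  case (All p)
  show ?case unfolding subst.simps fv.simps All.IH by (rule fv_under)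
next
  case (Ex p)
  show ?case unfolding subst.simps fv.simps Ex.IH by (rule fv_under)
qed (auto simp: fv_trm_subst)

lemma fv_lift: "fv (lift p) = Suc ` fv p"
  by (auto simp: lift_def fv_subst)

section \<open>Intuitionistic derivability\<close>

lemma deriv_mono: "deriv T G p \<Longrightarrow> G \<subseteq> H \<Longrightarrow> deriv T H p"
proof (induction arbitrary: H rule: deriv.induct)
  case (OrE G p q r)
  then show ?case by (metis deriv.OrE insert_mono)
next
  case (ImpI p G q)
  then show ?case by (metis deriv.ImpI insert_mono)
next
  case (AllI G p)
  then show ?case by (metis deriv.AllI image_mono)
next
  case (ExE G p q)
  then show ?case by (metis deriv.ExE image_mono insert_mono)
qed (blast intro: deriv.intros)+

lemma deriv_mono_axioms: "deriv T G p \<Longrightarrow> T \<subseteq> T' \<Longrightarrow> deriv T' G p"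
  by (induction rule: deriv.induct) (blast intro: deriv.intros)+

lemma deriv_weaken: "deriv T {} p \<Longrightarrow> deriv T G p"
  by (rule deriv_mono) auto

lemma deriv_And: "deriv T G (And p q) \<longleftrightarrow> deriv T G p \<and> deriv T G q"
  by (blast intro: deriv.intros)

text \<open>Contexts act as the worlds of a Kripke model. With this reading, intuitionistic propositional
  reasoning in the calculus becomes first-order reasoning in the metalogic.\<close>

lemma deriv_Imp:
  assumes "wf_fm p"
  shows "deriv T G (Imp p q) \<longleftrightarrow> (\<forall>H. G \<subseteq> H \<longrightarrow> deriv T H p \<longrightarrow> deriv T H q)"
proof
  assume "\<forall>H. G \<subseteq> H \<longrightarrow> deriv T H p \<longrightarrow> deriv T H q"
  then have "deriv T (insert p G) q" using assms by (blast intro: deriv.Hyp)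
  then show "deriv T G (Imp p q)" using assms by (rule deriv.ImpI)
qed (blast intro: deriv.ImpE deriv_mono)

lemma deriv_cut: "deriv T {p} q \<Longrightarrow> wf_fm p \<Longrightarrow> deriv T G p \<Longrightarrow> deriv T G q"
  by (meson deriv.ImpE deriv.ImpI deriv_weaken)

lemma deriv_Imp_Fls:
  "deriv T (insert p G) Fls \<Longrightarrow> wf_fm p \<Longrightarrow> wf_fm q \<Longrightarrow> deriv T G (Imp p q)"
  by (blast intro: deriv.ImpI deriv.FlsE)

text \<open>\<open>Fls\<close> has no free variables, so a contradiction reached with a fresh
  variable can be generalised and instantiated at any term. Refutations that introduce an
  eigenvariable end with this.\<close>

lemma deriv_lift_Fls: "deriv T (lift ` G) Fls \<Longrightarrow> deriv T G Fls"
  using deriv.AllE[OF deriv.AllI, of T G Fls zero] by (simp add: inst_def)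

section \<open>Derivations under substitution\<close>

definition closed_under_subst :: "fm set \<Rightarrow> bool" where
  "closed_under_subst T \<longleftrightarrow> (\<forall>p \<in> T. \<forall>\<sigma>. (\<forall>n. wf_trm (\<sigma> n)) \<longrightarrow> subst \<sigma> p \<in> T)"

text \<open>\<open>AllI\<close> and \<open>ExE\<close> lift the hypotheses but not the axioms, so
  the axiom set has to supply its own substitution instances. Below an eigenvariable the
  substitution acts as \<open>under \<sigma>\<close>, which commutes with lifting the
  context.\<close>

lemma deriv_subst:
  assumes "closed_under_subst T"
  shows "deriv T G p \<Longrightarrow> (\<And>n. wf_trm (\<sigma> n)) \<Longrightarrow> deriv T (subst \<sigma> ` G) (subst \<sigma> p)"
proof (induction arbitrary: \<sigma> rule: deriv.induct)
  case (Ax p G)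
  then show ?case using assms by (auto simp: closed_under_subst_def intro: deriv.Ax)
next
  case (AllI G p)
  have "deriv T (subst (under \<sigma>) ` lift ` G) (subst (under \<sigma>) p)"
    by (rule AllI.IH) (simp add: wf_under AllI.prems)
  moreover have "subst (under \<sigma>) ` lift ` G = lift ` subst \<sigma> ` G"
    by (simp add: image_image subst_under_lift)
  ultimately show ?case by (simp add: deriv.AllI)
next
  case (AllE G p t)
  from AllE.IH[OF AllE.prems] show ?case
    by (simp add: subst_inst deriv.AllE wf_subst_trm AllE)
next
  case (ExI G p t)
  from ExI.IH[OF ExI.prems] show ?case
    by (auto simp: subst_inst intro!: deriv.ExI[where t = "subst_trm \<sigma> t"] wf_subst_trm ExI)
next
  case (ExE G p q)
  have "deriv T (subst (under \<sigma>) ` insert p (lift ` G)) (subst (under \<sigma>) (lift q))"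
    by (rule ExE.IH) (simp add: wf_under ExE.prems)
  moreover have "subst (under \<sigma>) ` insert p (lift ` G) =
      insert (subst (under \<sigma>) p) (lift ` subst \<sigma> ` G)"
    by (simp add: image_image subst_under_lift)
  moreover have "deriv T (subst \<sigma> ` G) (Ex (subst (under \<sigma>) p))"
    using ExE.IH(1)[of \<sigma>] ExE.prems by simp
  ultimately show ?case
    by (metis deriv.ExE subst_under_lift)
next
  case (OrE G p q r)
  have "deriv T (insert (subst \<sigma> p) (subst \<sigma> ` G)) (subst \<sigma> r)"
    "deriv T (insert (subst \<sigma> q) (subst \<sigma> ` G)) (subst \<sigma> r)"
    "deriv T (subst \<sigma> ` G) (Or (subst \<sigma> p) (subst \<sigma> q))"
    using OrE.IH(2,3,1)[OF OrE.prems] by simp_all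
  then show ?case by (blast intro: deriv.OrE)
next
  case (ImpE G p q)
  then show ?case by (metis deriv.ImpE subst.simps(5))
next
  case (AndE1 G p q)
  then show ?case by (metis deriv.AndE1 subst.simps(3))
next
  case (AndE2 G p q)
  then show ?case by (metis deriv.AndE2 subst.simps(3))
next
  case (ImpI p G q)
  then have "deriv T (insert (subst \<sigma> p) (subst \<sigma> ` G)) (subst \<sigma> q)" by simp
  then show ?case using ImpI by (simp add: deriv.ImpI wf_subst)
next
  case (OrI1 G p q)
  then show ?case by (simp add: deriv.OrI1 wf_subst)
next
  case (OrI2 G q p)
  then show ?case by (simp add: deriv.OrI2 wf_subst)
qed (auto intro: deriv.intros wf_subst)

lemma deriv_lift: "closed_under_subst T \<Longrightarrow> deriv T G p \<Longrightarrow> deriv T (lift ` G) (lift p)"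
  unfolding lift_def by (rule deriv_subst) simp_all

text \<open>The clause for \<forall> in the reading of contexts as worlds: the lifted context has a
  fresh individual, named by variable 0. From left to right, lift and instantiate at that
  variable.\<close>

lemma deriv_All:
  assumes "closed_under_subst T"
  shows "deriv T G (All p) \<longleftrightarrow> deriv T (lift ` G) p"
proof
  assume "deriv T G (All p)"
  then have "deriv T (lift ` G) (lift (All p))" by (rule deriv_lift[OF assms])
  then have "deriv T (lift ` G) (inst (subst (under (\<lambda>n. Var (Suc n))) p) (Var 0))"
    by (intro deriv.AllE) (simp_all add: lift_def)
  then show "deriv T (lift ` G) p" by (simp add: inst_subst_under)
qed (rule deriv.AllI)

lemma deriv_Ex_lift:
  assumes "deriv T G p" shows "deriv T G (lift (Ex p))"
proof -
  have "deriv T G (inst (subst (under (\<lambda>n. Var (Suc n))) p) (Var 0))"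
    using assms by (simp add: inst_subst_under)
  then show ?thesis by (auto simp: lift_def intro!: deriv.ExI[where t = "Var 0"])
qed


section \<open>Well-formedness of derivable formulas\<close>

lemma wf_trm_of_subst: "wf_trm (subst_trm \<sigma> t) \<Longrightarrow> wf_trm t"
  by (induction t) auto

text \<open>Well-formedness has to be read backwards in \<open>wf_deriv\<close>, where the premises
  of \<open>ExI\<close> and \<open>ExE\<close> give it only for \<open>inst p t\<close> and
  \<open>lift q\<close>.\<close>

lemma wf_of_subst: "wf_fm (subst \<sigma> p) \<Longrightarrow> wf_fm p"
  by (induction p arbitrary: \<sigma>) (auto dest: wf_trm_of_subst)

lemma wf_inst: "wf_fm p \<Longrightarrow> wf_trm t \<Longrightarrow> wf_fm (inst p t)"
  unfolding inst_def by (rule wf_subst) (auto split: nat.split)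

lemma wf_deriv: "deriv T G p \<Longrightarrow> (\<And>q. q \<in> T \<Longrightarrow> wf_fm q) \<Longrightarrow> wf_fm p"
  by (induction rule: deriv.induct) (auto simp: inst_def lift_def wf_inst[unfolded inst_def] dest: wf_of_subst)

section \<open>Arithmetic\<close>

lemma wf_HA: "p \<in> HA \<Longrightarrow> wf_fm p"
  by (induction rule: HA.induct) (auto intro!: wf_inst wf_subst split: nat.split)

lemma wf_HA_deriv: "deriv HA G p \<Longrightarrow> wf_fm p"
  using wf_deriv wf_HA by blast

lemma closed_HA: "closed_under_subst HA"
  unfolding closed_under_subst_def
proof (intro ballI allI impI)
  fix p and \<sigma> :: "nat \<Rightarrow> trm" assume "p \<in> HA" and \<sigma>: "\<forall>n. wf_trm (\<sigma> n)"
  then show "subst \<sigma> p \<in> HA"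
  proof (induction rule: HA.induct)
    case (eq_subst s t p)
    then show ?case by (simp add: subst_inst HA.eq_subst wf_subst_trm wf_subst wf_under)
  next
    case (proj n i ts)
    then have "wf_trm (Fn (Proj n i) (map (subst_trm \<sigma>) ts))" by (auto intro: wf_subst_trm)
    then show ?case using HA.proj[of n i "map (subst_trm \<sigma>) ts"] proj by simp
  next
    case (comp n f gs ts)
    then have "wf_trm (Fn (Comp n f gs) (map (subst_trm \<sigma>) ts))" by (auto intro: wf_subst_trm)
    then show ?case using HA.comp[of n f gs "map (subst_trm \<sigma>) ts"] by (simp add: comp_def)
  next
    case (rec_zero f g ts)
    then have "wf_trm (Fn (Rec f g) (zero # map (subst_trm \<sigma>) ts))" by (auto intro: wf_subst_trm)
    then show ?case using HA.rec_zero[of f g "map (subst_trm \<sigma>) ts"] by simp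
  next
    case (rec_succ f g t ts)
    then have "wf_trm (Fn (Rec f g) (succ (subst_trm \<sigma> t) # map (subst_trm \<sigma>) ts))"
      by (auto intro: wf_subst_trm)
    then show ?case using HA.rec_succ[of f g "subst_trm \<sigma> t" "map (subst_trm \<sigma>) ts"] by simp
  next
    case (induction p)
    let ?s = "case_nat (succ (Var 0)) (\<lambda>n. Var (Suc n))"
    have "subst (under \<sigma>) (subst ?s p) = subst ?s (subst (under \<sigma>) p)"
      unfolding subst_comp
      by (rule arg_cong[where f = "\<lambda>\<sigma>. subst \<sigma> p"], rule ext)
         (auto simp: under_def subst_trm_comp split: nat.split)
    then show ?case using HA.induction[of "subst (under \<sigma>) p"] induction
      by (simp add: subst_inst wf_subst wf_under)
  qed (auto intro: HA.intros wf_subst_trm)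
qed

section \<open>Equality\<close>

lemma HA_refl: "wf_trm t \<Longrightarrow> deriv HA G (Eq t t)"
  by (blast intro: deriv.Ax HA.eq_refl)

lemma HA_replace:
  assumes "deriv HA G (Eq s t)" "deriv HA G (inst p s)"
  shows "deriv HA G (inst p t)"
proof -
  have "wf_trm s" "wf_trm t" using wf_HA_deriv[OF assms(1)] by auto
  moreover have "wf_fm p" using wf_HA_deriv[OF assms(2)] by (auto simp: inst_def dest: wf_of_subst)
  ultimately have "deriv HA G (Imp (Eq s t) (Imp (inst p s) (inst p t)))"
    by (blast intro: deriv.Ax HA.eq_subst)
  then show ?thesis using assms by (blast intro: deriv.ImpE)
qed

lemma subst_trm_lifted [simp]:
  "subst_trm (case_nat t Var) (subst_trm (\<lambda>n. Var (Suc n)) s) = s"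
  by (simp add: subst_trm_comp)

text \<open>Replacement acts on a template in which variable 0 marks the occurrence to be changed;
  the side that stays is lifted so that it avoids the mark. Transitivity and congruence use the same
  device.\<close>

lemma HA_sym: "deriv HA G (Eq s t) \<Longrightarrow> deriv HA G (Eq t s)"
  using HA_replace[of G s t "Eq (Var 0) (subst_trm (\<lambda>n. Var (Suc n)) s)"]
    HA_refl[of s G] wf_HA_deriv[of G "Eq s t"] by (simp add: inst_def)

lemma HA_trans [trans]: "deriv HA G (Eq s t) \<Longrightarrow> deriv HA G (Eq t u) \<Longrightarrow> deriv HA G (Eq s u)"
  using HA_replace[of G t u "Eq (subst_trm (\<lambda>n. Var (Suc n)) s) (Var 0)"] by (simp add: inst_def)

lemma HA_cong:
  assumes "deriv HA G (Eq s t)" "wf_sym f" "arity f = 1"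
  shows "deriv HA G (Eq (Fn f [s]) (Fn f [t]))"
  using HA_replace[of G s t "Eq (Fn f [subst_trm (\<lambda>n. Var (Suc n)) s]) (Fn f [Var 0])"]
    HA_refl[of "Fn f [s]" G] wf_HA_deriv[OF assms(1)] assms by (simp add: inst_def)

lemma HA_succ_inj: "deriv HA G (Eq (succ s) (succ t)) \<Longrightarrow> deriv HA G (Eq s t)"
  using wf_HA_deriv[of G "Eq (succ s) (succ t)"] deriv.ImpE[OF deriv.Ax[OF HA.succ_inj]] by auto

lemma HA_succ_zero: "deriv HA G (Eq (succ t) zero) \<Longrightarrow> deriv HA G Fls"
  using wf_HA_deriv[of G "Eq (succ t) zero"] deriv.ImpE[OF deriv.Ax[OF HA.succ_nonzero]] by auto

lemma HA_zero_succ: "deriv HA G (Eq zero (succ t)) \<Longrightarrow> deriv HA G Fls"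
  by (blast intro: HA_sym HA_succ_zero)

section \<open>Doubling and pairing\<close>

definition dbl :: sym where
  "dbl = Rec Zero (Comp 2 Succ [Comp 2 Succ [Proj 2 1]])"

text \<open>The coding \<open>\<langle>x, y\<rangle> = 2\<^sup>x (2 y + 1)\<close> is injective because the ranges of \<open>2 y + 1\<close> and \<open>2 n\<close> are disjoint.\<close>

definition pair :: sym where
  "pair = Rec (Comp 1 Succ [dbl]) (Comp 3 dbl [Proj 3 1])"

lemma wf_dbl [simp]: "wf_sym dbl" "arity dbl = 1"
  by (simp_all add: dbl_def)

lemma wf_pair [simp]: "wf_sym pair" "arity pair = 2"
  by (simp_all add: pair_def)

lemma dbl_zero: "deriv HA G (Eq (Fn dbl [zero]) zero)"
  unfolding dbl_def by (intro deriv.Ax HA.rec_zero) simp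

text \<open>\<open>Rec\<close> hands its step function the predecessor and then the recursive value,
  so \<open>Proj 2 1\<close> in \<open>dbl\<close>, like \<open>Proj 3 1\<close> in
  \<open>pair\<close>, selects the latter.\<close>

lemma dbl_succ:
  assumes "wf_trm t"
  shows "deriv HA G (Eq (Fn dbl [succ t]) (succ (succ (Fn dbl [t]))))"
proof -
  let ?g = "Comp 2 Succ [Proj 2 1]"
  have "deriv HA G (Eq (Fn dbl [succ t]) (Fn (Comp 2 Succ [?g]) [t, Fn dbl [t]]))"
    using assms unfolding dbl_def by (intro deriv.Ax HA.rec_succ) simp
  also have "deriv HA G (Eq (Fn (Comp 2 Succ [?g]) [t, Fn dbl [t]]) (succ (Fn ?g [t, Fn dbl [t]])))"
    using HA.comp[of 2 Succ "[?g]" "[t, Fn dbl [t]]"] assms by (intro deriv.Ax) simp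
  also have "deriv HA G (Eq (succ (Fn ?g [t, Fn dbl [t]])) (succ (succ (Fn dbl [t]))))"
  proof (rule HA_cong)
    have "deriv HA G (Eq (Fn ?g [t, Fn dbl [t]]) (succ (Fn (Proj 2 1) [t, Fn dbl [t]])))"
      using HA.comp[of 2 Succ "[Proj 2 1]" "[t, Fn dbl [t]]"] assms by (intro deriv.Ax) simp
    also have "deriv HA G (Eq (succ (Fn (Proj 2 1) [t, Fn dbl [t]])) (succ (Fn dbl [t])))"
      using HA.proj[of 2 1 "[t, Fn dbl [t]]"] assms by (intro HA_cong deriv.Ax) simp_all
    finally show "deriv HA G (Eq (Fn ?g [t, Fn dbl [t]]) (succ (Fn dbl [t])))" .
  qed simp_all
  finally show ?thesis .
qed

lemma pair_zero:
  assumes "wf_trm t"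
  shows "deriv HA G (Eq (Fn pair [zero, t]) (succ (Fn dbl [t])))"
proof -
  have "deriv HA G (Eq (Fn pair [zero, t]) (Fn (Comp 1 Succ [dbl]) [t]))"
    using assms unfolding pair_def by (intro deriv.Ax HA.rec_zero) simp
  also have "deriv HA G (Eq (Fn (Comp 1 Succ [dbl]) [t]) (succ (Fn dbl [t])))"
    using HA.comp[of 1 Succ "[dbl]" "[t]"] assms by (intro deriv.Ax) simp
  finally show ?thesis .
qed

lemma pair_succ:
  assumes "wf_trm s" "wf_trm t"
  shows "deriv HA G (Eq (Fn pair [succ s, t]) (Fn dbl [Fn pair [s, t]]))"
proof -
  let ?ts = "[s, Fn pair [s, t], t]"
  have "deriv HA G (Eq (Fn pair [succ s, t]) (Fn (Comp 3 dbl [Proj 3 1]) ?ts))"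
    using assms unfolding pair_def by (intro deriv.Ax HA.rec_succ) simp
  also have "deriv HA G (Eq (Fn (Comp 3 dbl [Proj 3 1]) ?ts) (Fn dbl [Fn (Proj 3 1) ?ts]))"
    using HA.comp[of 3 dbl "[Proj 3 1]" ?ts] assms by (intro deriv.Ax) simp
  also have "deriv HA G (Eq (Fn dbl [Fn (Proj 3 1) ?ts]) (Fn dbl [Fn pair [s, t]]))"
    using HA.proj[of 3 1 ?ts] assms by (intro HA_cong deriv.Ax) simp_all
  finally show ?thesis .
qed

section \<open>Arithmetical inductions: parity, decidable equality, injectivity of pairing\<close>

lemma HA_induct:
  assumes "wf_fm p" "deriv HA G (inst p zero)"
    "deriv HA (insert p (lift ` G)) (subst (case_nat (succ (Var 0)) (\<lambda>n. Var (Suc n))) p)"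
  shows "deriv HA G (All p)"
  using deriv.ImpE[OF deriv.Ax[OF HA.induction]] assms by (blast intro: deriv.intros)

lemma HA_cases:
  assumes "wf_fm p" "deriv HA G (inst p zero)"
    "deriv HA (lift ` G) (subst (case_nat (succ (Var 0)) (\<lambda>n. Var (Suc n))) p)"
  shows "deriv HA G (All p)"
  using assms by (blast intro: HA_induct deriv_mono)


abbreviation succ_subst :: "nat \<Rightarrow> trm" where
  "succ_subst \<equiv> case_nat (succ (Var 0)) (\<lambda>n. Var (Suc n))"

lemma HA_specialise: "All p \<in> G \<Longrightarrow> wf_fm p \<Longrightarrow> wf_trm t \<Longrightarrow> deriv HA G (inst p t)"
  by (rule deriv.AllE[OF deriv.Hyp]) simp_all

text \<open>The second variable stays quantified inside the induction formula because it decreases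
  along with the first: 2(x+1) = 2(y+1) + 1 cancels to 2x = 2y + 1. On the second variable a case
  distinction suffices. \<open>dbl_inj_All\<close>, \<open>eq_decidable_All\<close> and
  \<open>pair_inj_All\<close> follow this pattern.\<close>

lemma dbl_neq_succ_dbl_All:
  "HA \<turnstile> All (All (Neg (Eq (Fn dbl [Var (Suc 0)]) (succ (Fn dbl [Var 0])))))"
  (is "HA \<turnstile> All ?p")
proof (rule HA_induct)
  have "deriv HA {Eq (Fn dbl [zero]) (succ (Fn dbl [Var 0]))} Fls" (is "deriv HA ?G Fls")
  proof -
    have "deriv HA ?G (Eq zero (Fn dbl [zero]))" by (rule HA_sym[OF dbl_zero])
    also have "deriv HA ?G (Eq (Fn dbl [zero]) (succ (Fn dbl [Var 0])))" by (rule deriv.Hyp) auto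
    finally show "deriv HA ?G Fls" by (rule HA_zero_succ)
  qed
  then show "HA \<turnstile> inst ?p zero"
    by (simp add: inst_def) (intro deriv.AllI deriv.ImpI; simp)
next
  have "deriv HA {?p} (All (Neg (Eq (Fn dbl [succ (Var (Suc 0))]) (succ (Fn dbl [Var 0])))))"
    (is "deriv HA _ (All ?q)")
  proof (rule HA_cases)
    have "deriv HA {Eq (Fn dbl [succ (Var 0)]) (succ (Fn dbl [zero])), ?p} Fls"
      (is "deriv HA ?G Fls")
    proof -
      have "deriv HA ?G (Eq (succ (succ (Fn dbl [Var 0]))) (Fn dbl [succ (Var 0)]))"
        by (rule HA_sym, rule dbl_succ) simp
      also have "deriv HA ?G (Eq (Fn dbl [succ (Var 0)]) (succ (Fn dbl [zero])))"
        by (rule deriv.Hyp) auto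
      finally have "deriv HA ?G (Eq (succ (Fn dbl [Var 0])) (Fn dbl [zero]))"
        by (rule HA_succ_inj)
      also have "deriv HA ?G (Eq (Fn dbl [zero]) zero)" by (rule dbl_zero)
      finally show ?thesis by (rule HA_succ_zero)
    qed
    then show "deriv HA {?p} (inst ?q zero)"
      by (simp add: inst_def) (intro deriv.ImpI; simp)
  next
    have "deriv HA {Eq (Fn dbl [succ (Var (Suc 0))]) (succ (Fn dbl [succ (Var 0)])), lift ?p} Fls"
      (is "deriv HA ?G Fls")
    proof -
      have "deriv HA ?G (Eq (succ (succ (Fn dbl [Var (Suc 0)]))) (Fn dbl [succ (Var (Suc 0))]))"
        by (rule HA_sym, rule dbl_succ) simp
      also have "deriv HA ?G (Eq (Fn dbl [succ (Var (Suc 0))]) (succ (Fn dbl [succ (Var 0)])))"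
        by (rule deriv.Hyp) auto
      finally have "deriv HA ?G (Eq (succ (Fn dbl [Var (Suc 0)])) (Fn dbl [succ (Var 0)]))"
        by (rule HA_succ_inj)
      also have "deriv HA ?G (Eq (Fn dbl [succ (Var 0)]) (succ (succ (Fn dbl [Var 0]))))"
        by (rule dbl_succ) simp
      finally have "deriv HA ?G (Eq (Fn dbl [Var (Suc 0)]) (succ (Fn dbl [Var 0])))"
        by (rule HA_succ_inj)
      moreover have "deriv HA ?G (Neg (Eq (Fn dbl [Var (Suc 0)]) (succ (Fn dbl [Var 0]))))"
        using HA_specialise[of "Neg (Eq (Fn dbl [Var (Suc (Suc 0))]) (succ (Fn dbl [Var 0])))"
            ?G "Var 0"] by (simp add: inst_def)
      ultimately show ?thesis by (rule deriv.ImpE[rotated])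
    qed
    then show "deriv HA (lift ` {?p}) (subst succ_subst ?q)"
      by simp (intro deriv.ImpI; simp)
  qed simp
  then show "deriv HA (insert ?p (lift ` {})) (subst succ_subst ?p)" by simp
qed simp

lemma dbl_inj_All:
  "HA \<turnstile> All (All (Imp (Eq (Fn dbl [Var (Suc 0)]) (Fn dbl [Var 0])) (Eq (Var (Suc 0)) (Var 0))))"
  (is "HA \<turnstile> All ?p")
proof (rule HA_induct)
  have "HA \<turnstile> All (Imp (Eq (Fn dbl [zero]) (Fn dbl [Var 0])) (Eq zero (Var 0)))"
    (is "HA \<turnstile> All ?q")
  proof (rule HA_cases)
    show "HA \<turnstile> inst ?q zero"
      by (simp add: inst_def) (intro deriv.ImpI HA_refl; simp)
  next
    have "deriv HA {Eq (Fn dbl [zero]) (Fn dbl [succ (Var 0)])} Fls" (is "deriv HA ?G Fls")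
    proof -
      have "deriv HA ?G (Eq zero (Fn dbl [zero]))" by (rule HA_sym[OF dbl_zero])
      also have "deriv HA ?G (Eq (Fn dbl [zero]) (Fn dbl [succ (Var 0)]))"
        by (rule deriv.Hyp) auto
      also have "deriv HA ?G (Eq (Fn dbl [succ (Var 0)]) (succ (succ (Fn dbl [Var 0]))))"
        by (rule dbl_succ) simp
      finally show ?thesis by (rule HA_zero_succ)
    qed
    then show "deriv HA (lift ` {}) (subst succ_subst ?q)"
      by simp (intro deriv_Imp_Fls; simp)
  qed simp
  then show "HA \<turnstile> inst ?p zero" by (simp add: inst_def)
next
  have "deriv HA {?p} (All (Imp (Eq (Fn dbl [succ (Var (Suc 0))]) (Fn dbl [Var 0]))
      (Eq (succ (Var (Suc 0))) (Var 0))))"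
    (is "deriv HA _ (All ?q)")
  proof (rule HA_cases)
    have "deriv HA {Eq (Fn dbl [succ (Var 0)]) (Fn dbl [zero]), ?p} Fls"
      (is "deriv HA ?G Fls")
    proof -
      have "deriv HA ?G (Eq (succ (succ (Fn dbl [Var 0]))) (Fn dbl [succ (Var 0)]))"
        by (rule HA_sym, rule dbl_succ) simp
      also have "deriv HA ?G (Eq (Fn dbl [succ (Var 0)]) (Fn dbl [zero]))"
        by (rule deriv.Hyp) auto
      also have "deriv HA ?G (Eq (Fn dbl [zero]) zero)" by (rule dbl_zero)
      finally show ?thesis by (rule HA_succ_zero)
    qed
    then show "deriv HA {?p} (inst ?q zero)"
      by (simp add: inst_def) (intro deriv_Imp_Fls; simp)
  next
    have "deriv HA {Eq (Fn dbl [succ (Var (Suc 0))]) (Fn dbl [succ (Var 0)]), lift ?p}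
        (Eq (succ (Var (Suc 0))) (succ (Var 0)))"
      (is "deriv HA ?G _")
    proof -
      have "deriv HA ?G (Eq (succ (succ (Fn dbl [Var (Suc 0)]))) (Fn dbl [succ (Var (Suc 0))]))"
        by (rule HA_sym, rule dbl_succ) simp
      also have "deriv HA ?G (Eq (Fn dbl [succ (Var (Suc 0))]) (Fn dbl [succ (Var 0)]))"
        by (rule deriv.Hyp) auto
      also have "deriv HA ?G (Eq (Fn dbl [succ (Var 0)]) (succ (succ (Fn dbl [Var 0]))))"
        by (rule dbl_succ) simp
      finally have "deriv HA ?G (Eq (Fn dbl [Var (Suc 0)]) (Fn dbl [Var 0]))"
        by (blast intro: HA_succ_inj)
      moreover have "deriv HA ?G (Imp (Eq (Fn dbl [Var (Suc 0)]) (Fn dbl [Var 0]))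
          (Eq (Var (Suc 0)) (Var 0)))"
        using HA_specialise[of "Imp (Eq (Fn dbl [Var (Suc (Suc 0))]) (Fn dbl [Var 0]))
          (Eq (Var (Suc (Suc 0))) (Var 0))" ?G "Var 0"] by (simp add: inst_def)
      ultimately have "deriv HA ?G (Eq (Var (Suc 0)) (Var 0))" by (rule deriv.ImpE[rotated])
      then show ?thesis by (rule HA_cong) simp_all
    qed
    then show "deriv HA (lift ` {?p}) (subst succ_subst ?q)"
      by simp (intro deriv.ImpI; simp)
  qed simp
  then show "deriv HA (insert ?p (lift ` {})) (subst succ_subst ?p)" by simp
qed simp

lemma deriv_AllE2:
  assumes "deriv T G (All (All p))" "wf_trm s" "wf_trm t"
  shows "deriv T G (subst (case_nat t (case_nat s Var)) p)"
proof -
  have "deriv T G (inst (All p) s)" using assms by (blast intro: deriv.AllE)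
  then have "deriv T G (inst (subst (under (case_nat s Var)) p) t)"
    unfolding inst_def[of "All p"] subst.simps using assms by (blast intro: deriv.AllE)
  then show ?thesis by (simp add: inst_subst_under)
qed

lemma deriv_AllE3:
  assumes "deriv T G (All (All (All p)))" "wf_trm s" "wf_trm t" "wf_trm u"
  shows "deriv T G (subst (case_nat u (case_nat t (case_nat s Var))) p)"
proof -
  have "deriv T G (subst (case_nat t (case_nat s Var)) (All p))"
    using assms by (blast intro: deriv_AllE2)
  then have "deriv T G (inst (subst (under (case_nat t (case_nat s Var))) p) u)"
    unfolding subst.simps using assms by (blast intro: deriv.AllE)
  then show ?thesis by (simp add: inst_subst_under)
qed

lemma dbl_neq_succ_dbl:
  assumes "deriv HA G (Eq (Fn dbl [s]) (succ (Fn dbl [t])))"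
  shows "deriv HA G Fls"
  using deriv_AllE2[OF deriv_weaken[OF dbl_neq_succ_dbl_All], of s t G] wf_HA_deriv[OF assms] assms
  by (auto intro: deriv.ImpE)

lemma dbl_inj:
  assumes "deriv HA G (Eq (Fn dbl [s]) (Fn dbl [t]))"
  shows "deriv HA G (Eq s t)"
  using deriv_AllE2[OF deriv_weaken[OF dbl_inj_All], of s t G] wf_HA_deriv[OF assms] assms
  by (auto intro: deriv.ImpE)

lemma eq_decidable_All:
  "HA \<turnstile> All (All (Or (Eq (Var (Suc 0)) (Var 0)) (Neg (Eq (Var (Suc 0)) (Var 0)))))"
  (is "HA \<turnstile> All ?p")
proof (rule HA_induct)
  have "HA \<turnstile> All (Or (Eq zero (Var 0)) (Neg (Eq zero (Var 0))))"
    (is "HA \<turnstile> All ?q")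
  proof (rule HA_cases)
    show "HA \<turnstile> inst ?q zero"
      by (simp add: inst_def) (intro deriv.OrI1 HA_refl; simp)
  next
    have "deriv HA {Eq zero (succ (Var 0))} Fls"
      by (rule HA_zero_succ[of _ "Var 0"], rule deriv.Hyp) simp_all
    then show "deriv HA (lift ` {}) (subst succ_subst ?q)"
      by simp (intro deriv.OrI2 deriv.ImpI; simp)
  qed simp
  then show "HA \<turnstile> inst ?p zero" by (simp add: inst_def)
next
  have "deriv HA {?p} (All (Or (Eq (succ (Var (Suc 0))) (Var 0))
      (Neg (Eq (succ (Var (Suc 0))) (Var 0)))))"
    (is "deriv HA _ (All ?q)")
  proof (rule HA_cases)
    have "deriv HA {Eq (succ (Var 0)) zero, ?p} Fls"
      by (rule HA_succ_zero[of _ "Var 0"], rule deriv.Hyp) simp_all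
    then show "deriv HA {?p} (inst ?q zero)"
      by (simp add: inst_def) (intro deriv.OrI2 deriv.ImpI; simp)
  next
    let ?e = "Eq (Var (Suc 0)) (Var 0)" and ?e' = "Eq (succ (Var (Suc 0))) (succ (Var 0))"
    have "deriv HA {lift ?p} (Or ?e' (Neg ?e'))" (is "deriv HA ?G _")
    proof (rule deriv.OrE)
      show "deriv HA ?G (Or ?e (Neg ?e))"
        using HA_specialise[of "Or (Eq (Var (Suc (Suc 0))) (Var 0))
          (Neg (Eq (Var (Suc (Suc 0))) (Var 0)))" ?G "Var 0"] by (simp add: inst_def)
      show "deriv HA (insert ?e ?G) (Or ?e' (Neg ?e'))"
        by (rule deriv.OrI1, rule HA_cong, rule deriv.Hyp) simp_all
      have "deriv HA (insert ?e' (insert (Neg ?e) ?G)) ?e"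
        by (rule HA_succ_inj, rule deriv.Hyp) simp_all
      moreover have "deriv HA (insert ?e' (insert (Neg ?e) ?G)) (Neg ?e)"
        by (rule deriv.Hyp) simp_all
      ultimately show "deriv HA (insert (Neg ?e) ?G) (Or ?e' (Neg ?e'))"
        by (intro deriv.OrI2 deriv.ImpI) (auto intro: deriv.ImpE)
    qed
    then show "deriv HA (lift ` {?p}) (subst succ_subst ?q)" by simp
  qed simp
  then show "deriv HA (insert ?p (lift ` {})) (subst succ_subst ?p)" by simp
qed simp

lemma eq_decidable: "wf_trm s \<Longrightarrow> wf_trm t \<Longrightarrow> deriv HA G (Or (Eq s t) (Neg (Eq s t)))"
  using deriv_AllE2[OF deriv_weaken[OF eq_decidable_All], of s t G] by simp

text \<open>The quantifiers stand in the order x, x', y, y': induction runs on x, the case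
  distinction on x'. If both exponents are zero, cancel successor and doubling; if both are
  positive, cancel one doubling; if just one is zero, an odd number would equal an even one.\<close>

lemma pair_inj_All:
  "HA \<turnstile> All (All (All (All (Imp
     (Eq (Fn pair [Var (Suc (Suc (Suc 0))), Var (Suc 0)]) (Fn pair [Var (Suc (Suc 0)), Var 0]))
     (And (Eq (Var (Suc (Suc (Suc 0)))) (Var (Suc (Suc 0)))) (Eq (Var (Suc 0)) (Var 0)))))))"
  (is "HA \<turnstile> All ?p")
proof (rule HA_induct)
  let ?x = "Var (Suc (Suc 0))" and ?y = "Var (Suc 0)" and ?y' = "Var 0"
  have "HA \<turnstile> All (All (All (Imp (Eq (Fn pair [zero, ?y]) (Fn pair [?x, ?y']))
     (And (Eq zero ?x) (Eq ?y ?y')))))"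
    (is "HA \<turnstile> All ?q")
  proof (rule HA_cases)
    have "deriv HA {Eq (Fn pair [zero, ?y]) (Fn pair [zero, ?y'])} (And (Eq zero zero) (Eq ?y ?y'))"
      (is "deriv HA ?G _")
    proof -
      have "deriv HA ?G (Eq (succ (Fn dbl [?y])) (Fn pair [zero, ?y]))"
        by (rule HA_sym, rule pair_zero) simp
      also have "deriv HA ?G (Eq (Fn pair [zero, ?y]) (Fn pair [zero, ?y']))"
        by (rule deriv.Hyp) auto
      also have "deriv HA ?G (Eq (Fn pair [zero, ?y']) (succ (Fn dbl [?y'])))"
        by (rule pair_zero) simp
      finally show ?thesis by (simp add: deriv_And HA_refl dbl_inj[OF HA_succ_inj])
    qed
    then show "HA \<turnstile> inst ?q zero"
      by (simp add: inst_def) (intro deriv.AllI deriv.ImpI; simp)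
  next
    have "deriv HA {Eq (Fn pair [zero, ?y]) (Fn pair [succ ?x, ?y'])} Fls"
      (is "deriv HA ?G _")
    proof -
      have "deriv HA ?G (Eq (Fn dbl [Fn pair [?x, ?y']]) (Fn pair [succ ?x, ?y']))"
        by (rule HA_sym, rule pair_succ) simp_all
      also have "deriv HA ?G (Eq (Fn pair [succ ?x, ?y']) (Fn pair [zero, ?y]))"
        by (rule HA_sym, rule deriv.Hyp) auto
      also have "deriv HA ?G (Eq (Fn pair [zero, ?y]) (succ (Fn dbl [?y])))"
        by (rule pair_zero) simp_all
      finally show ?thesis by (rule dbl_neq_succ_dbl)
    qed
    then show "deriv HA (lift ` {}) (subst succ_subst ?q)"
      by simp (intro deriv.AllI deriv_Imp_Fls; simp)
  qed simp
  then show "HA \<turnstile> inst ?p zero" by (simp add: inst_def)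
next
  let ?u = "Var (Suc (Suc (Suc 0)))" and ?x = "Var (Suc (Suc 0))" and ?y = "Var (Suc 0)"
    and ?y' = "Var 0"
  have "deriv HA {?p} (All (All (All (Imp (Eq (Fn pair [succ ?u, ?y]) (Fn pair [?x, ?y']))
     (And (Eq (succ ?u) ?x) (Eq ?y ?y'))))))"
    (is "deriv HA _ (All ?q)")
  proof (rule HA_cases)
    have "deriv HA {Eq (Fn pair [succ ?x, ?y]) (Fn pair [zero, ?y']), lift (lift ?p)} Fls"
      (is "deriv HA ?G _")
    proof -
      have "deriv HA ?G (Eq (Fn dbl [Fn pair [?x, ?y]]) (Fn pair [succ ?x, ?y]))"
        by (rule HA_sym, rule pair_succ) simp_all
      also have "deriv HA ?G (Eq (Fn pair [succ ?x, ?y]) (Fn pair [zero, ?y']))"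
        by (rule deriv.Hyp) auto
      also have "deriv HA ?G (Eq (Fn pair [zero, ?y']) (succ (Fn dbl [?y'])))"
        by (rule pair_zero) simp_all
      finally show ?thesis by (rule dbl_neq_succ_dbl)
    qed
    then show "deriv HA {?p} (inst ?q zero)"
      by (simp add: inst_def) (intro deriv.AllI deriv_Imp_Fls; simp)
  next
    have "deriv HA {Eq (Fn pair [succ ?u, ?y]) (Fn pair [succ ?x, ?y']), lift (lift (lift ?p))}
       (And (Eq (succ ?u) (succ ?x)) (Eq ?y ?y'))"
      (is "deriv HA ?G _")
    proof -
      have "deriv HA ?G (Eq (Fn dbl [Fn pair [?u, ?y]]) (Fn pair [succ ?u, ?y]))"
        by (rule HA_sym, rule pair_succ) simp_all
      also have "deriv HA ?G (Eq (Fn pair [succ ?u, ?y]) (Fn pair [succ ?x, ?y']))"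
        by (rule deriv.Hyp) auto
      also have "deriv HA ?G (Eq (Fn pair [succ ?x, ?y']) (Fn dbl [Fn pair [?x, ?y']]))"
        by (rule pair_succ) simp_all
      finally have eq: "deriv HA ?G (Eq (Fn pair [?u, ?y]) (Fn pair [?x, ?y']))"
        by (rule dbl_inj)
      have "deriv HA ?G (lift (lift (lift ?p)))" by (rule deriv.Hyp) simp_all
      then have "deriv HA ?G (Imp (Eq (Fn pair [?u, ?y]) (Fn pair [?x, ?y']))
          (And (Eq ?u ?x) (Eq ?y ?y')))"
        unfolding lift_simps subst.simps by (drule_tac deriv_AllE3[of _ _ _ ?x ?y ?y']) simp_all
      then have "deriv HA ?G (And (Eq ?u ?x) (Eq ?y ?y'))" using eq by (rule deriv.ImpE)
      then show ?thesis by (auto simp: deriv_And intro: HA_cong)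
    qed
    then show "deriv HA (lift ` {?p}) (subst succ_subst ?q)"
      by simp (intro deriv.AllI deriv.ImpI; simp)
  qed simp
  then show "deriv HA (insert ?p (lift ` {})) (subst succ_subst ?p)" by simp
qed simp


lemma pair_inj:
  assumes "deriv HA G (Eq (Fn pair [s, t]) (Fn pair [s', t']))"
  shows "deriv HA G (Eq s s')" "deriv HA G (Eq t t')"
proof -
  let ?u = "Var (Suc (Suc (Suc 0)))" and ?x = "Var (Suc (Suc 0))" and ?y = "Var (Suc 0)"
    and ?y' = "Var 0"
  have wf: "wf_trm s" "wf_trm t" "wf_trm s'" "wf_trm t'" using wf_HA_deriv[OF assms] by auto
  have "deriv HA G (inst (All (All (All (Imp (Eq (Fn pair [?u, ?y]) (Fn pair [?x, ?y']))
       (And (Eq ?u ?x) (Eq ?y ?y')))))) s)"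
    using pair_inj_All wf by (blast intro: deriv.AllE deriv_weaken)
  then have "deriv HA G (Imp (Eq (Fn pair [s, t]) (Fn pair [s', t'])) (And (Eq s s') (Eq t t')))"
    unfolding inst_def subst.simps
    by (drule_tac deriv_AllE3[of _ _ _ s' t t']) (simp_all add: wf subst_trm_comp)
  then show "deriv HA G (Eq s s')" "deriv HA G (Eq t t')"
    using deriv.ImpE[OF _ assms] deriv_And by blast+
qed

section \<open>Equivalence and stability in a theory\<close>

text \<open>Two derivations from a single hypothesis, together with well-formedness, are what a cut
  needs in an arbitrary context (\<open>equiv_in_iff\<close>).\<close>

definition equiv_in :: "fm set \<Rightarrow> fm \<Rightarrow> fm \<Rightarrow> bool" where
  "equiv_in T p q \<longleftrightarrow> wf_fm p \<and> wf_fm q \<and> deriv T {p} q \<and> deriv T {q} p"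

definition stable :: "fm set \<Rightarrow> fm \<Rightarrow> bool" where
  "stable T p \<longleftrightarrow> wf_fm p \<and> T \<turnstile> Imp (Neg (Neg p)) p"

lemma deriv_hyp: "wf_fm p \<Longrightarrow> deriv T (insert p G) p"
  by (simp add: deriv.Hyp)

lemma equiv_in_refl: "wf_fm p \<Longrightarrow> equiv_in T p p"
  by (simp add: equiv_in_def deriv_hyp)

lemma equiv_in_sym: "equiv_in T p q \<Longrightarrow> equiv_in T q p"
  by (simp add: equiv_in_def)

lemma equiv_in_iff: "equiv_in T p q \<Longrightarrow> deriv T G p \<longleftrightarrow> deriv T G q"
  unfolding equiv_in_def by (blast intro: deriv_cut)

lemma equiv_inI:
  "wf_fm p \<Longrightarrow> wf_fm q \<Longrightarrow> (\<And>G. deriv T G p \<longleftrightarrow> deriv T G q) \<Longrightarrow> equiv_in T p q"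
  unfolding equiv_in_def by (blast intro: deriv_hyp)

lemma equiv_in_wf: "equiv_in T p q \<Longrightarrow> wf_fm p \<and> wf_fm q"
  by (simp add: equiv_in_def)

lemma equiv_in_trans [trans]: "equiv_in T p q \<Longrightarrow> equiv_in T q r \<Longrightarrow> equiv_in T p r"
  by (rule equiv_inI) (auto simp: equiv_in_iff dest: equiv_in_wf)

lemma equiv_in_mono: "equiv_in T p q \<Longrightarrow> T \<subseteq> T' \<Longrightarrow> equiv_in T' p q"
  unfolding equiv_in_def by (blast intro: deriv_mono_axioms)

lemma equiv_in_Iff: "equiv_in T p q \<Longrightarrow> T \<turnstile> Iff p q"
  unfolding equiv_in_def by (blast intro: deriv.AndI deriv.ImpI)

lemma equiv_in_And:
  "equiv_in T p p' \<Longrightarrow> equiv_in T q q' \<Longrightarrow> equiv_in T (And p q) (And p' q')"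
  by (rule equiv_inI) (auto simp: equiv_in_iff deriv_And dest: equiv_in_wf)

lemma equiv_in_Imp:
  assumes "equiv_in T p p'" "equiv_in T q q'"
  shows "equiv_in T (Imp p q) (Imp p' q')"
  using assms equiv_in_wf[OF assms(1)] equiv_in_wf[OF assms(2)]
  by (intro equiv_inI) (auto simp: equiv_in_iff deriv_Imp)

lemma deriv_Ex_left:
  assumes "deriv T {p} (lift q)" "wf_fm p" shows "deriv T {Ex p} q"
proof (rule deriv.ExE)
  show "deriv T {Ex p} (Ex p)" using assms by (simp add: deriv_hyp)
  show "deriv T (insert p (lift ` {Ex p})) (lift q)" by (rule deriv_mono[OF assms(1)]) auto
qed

lemma equiv_in_Ex:
  assumes "equiv_in T p q"
  shows "equiv_in T (Ex p) (Ex q)"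
  using assms unfolding equiv_in_def by (auto intro!: deriv_Ex_left deriv_Ex_lift simp del: lift_simps)

lemma deriv_All_mono:
  assumes "closed_under_subst T" "wf_fm p" "deriv T {p} q"
  shows "deriv T {All p} (All q)"
proof -
  have "deriv T {All p} (All p)" using assms by (simp add: deriv_hyp)
  then show ?thesis unfolding deriv_All[OF assms(1)] using assms by (blast intro: deriv_cut)
qed

lemma equiv_in_All:
  "closed_under_subst T \<Longrightarrow> equiv_in T p q \<Longrightarrow> equiv_in T (All p) (All q)"
  unfolding equiv_in_def by (auto intro: deriv_All_mono)

lemma deriv_stable: "stable T p \<Longrightarrow> deriv T G (Neg (Neg p)) \<Longrightarrow> deriv T G p"
  unfolding stable_def by (blast intro: deriv.ImpE deriv_weaken)

lemma stable_equiv_in: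
  assumes "stable T p" "equiv_in T p q" shows "stable T q"
proof -
  have "equiv_in T (Imp (Neg (Neg p)) p) (Imp (Neg (Neg q)) q)"
    using assms(2) by (intro equiv_in_Imp equiv_in_refl) simp_all
  then show ?thesis using assms equiv_in_iff unfolding stable_def equiv_in_def by blast
qed

lemma stable_mono: "stable T p \<Longrightarrow> T \<subseteq> T' \<Longrightarrow> stable T' p"
  unfolding stable_def by (blast intro: deriv_mono_axioms)

lemma stable_subst:
  assumes "closed_under_subst T" "stable T p" "\<And>n. wf_trm (\<sigma> n)"
  shows "stable T (subst \<sigma> p)"
  using deriv_subst[OF assms(1), of "{}" "Imp (Neg (Neg p)) p" \<sigma>] assms
  by (simp add: stable_def wf_subst)

text \<open>As \<forall>x p implies p, \<not>\<not>\<forall>x p implies \<not>\<not>p for a fresh x;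
  stability of p removes the double negation, and x can be generalised.\<close>

lemma stable_All:
  assumes T: "closed_under_subst T" and p: "stable T p"
  shows "stable T (All p)"
proof -
  have wf: "wf_fm p" using p by (simp add: stable_def)
  let ?N = "Neg (Neg (All p))"
  have "deriv T {lift ?N} (Neg (Neg p))"
  proof (rule deriv.ImpI)
    let ?G = "{Neg p, lift ?N}"
    have "deriv T (insert (lift (All p)) ?G) p"
      using deriv_hyp[of "All p" T "{}"] wf unfolding deriv_All[OF T]
      by (auto intro: deriv_mono simp del: lift_simps)
    moreover have "deriv T (insert (lift (All p)) ?G) (Neg p)" using wf by (simp add: deriv.Hyp)
    ultimately have "deriv T (insert (lift (All p)) ?G) Fls" by (blast intro: deriv.ImpE)
    then have "deriv T ?G (lift (Neg (All p)))"
      using deriv.ImpI wf_lift[of "All p"] wf by simp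
    moreover have "deriv T ?G (lift ?N)" 
      using wf wf_lift[of "All p"] by (intro deriv.Hyp) auto
    ultimately show "deriv T ?G Fls" by (auto intro: deriv.ImpE)
  qed (use wf in simp)
  then have "deriv T (lift ` {?N}) p" using deriv_stable[OF p] by (simp del: lift_simps)
  then have "deriv T {?N} (All p)" by (rule deriv.AllI)
  then show ?thesis using wf by (simp add: stable_def deriv.ImpI)
qed

section \<open>Prenex classes\<close>

lemma Pi_subset_Sigma: "Pi_fm k \<subseteq> Sigma_fm (Suc k)"
  by (auto intro!: exI[of _ "0::nat"])

lemma Sigma_subset_Pi: "Sigma_fm k \<subseteq> Pi_fm (Suc k)"
  by (auto intro!: exI[of _ "0::nat"])

lemma Ex_in_Sigma: "p \<in> Sigma_fm (Suc k) \<Longrightarrow> Ex p \<in> Sigma_fm (Suc k)"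
  by (auto) (metis comp_apply funpow.simps(2))

lemma All_in_Pi: "p \<in> Pi_fm (Suc k) \<Longrightarrow> All p \<in> Pi_fm (Suc k)"
  by (auto) (metis comp_apply funpow.simps(2))

text \<open>Induction along the outer block, one quantifier at a time, replaces reasoning about the
  power \<open>Ex ^^ n\<close>. The base case is the empty block, that is, the dual class one level
  below.\<close>

lemma Sigma_Suc_induct [consumes 1, case_names base Ex]:
  assumes "p \<in> Sigma_fm (Suc k)" "\<And>p. p \<in> Pi_fm k \<Longrightarrow> P p"
    "\<And>p. p \<in> Sigma_fm (Suc k) \<Longrightarrow> P p \<Longrightarrow> P (Ex p)"
  shows "P p"
proof -
  obtain n q where "p = (Ex ^^ n) q" "q \<in> Pi_fm k" using assms(1) by auto
  moreover have "(Ex ^^ n) q \<in> Sigma_fm (Suc k) \<and> P ((Ex ^^ n) q)" if "q \<in> Pi_fm k" for n q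
    using that assms(2,3) Pi_subset_Sigma
    by (induction n) (auto simp del: Sigma_fm.simps intro: Ex_in_Sigma)
  ultimately show ?thesis by blast
qed

lemma Pi_Suc_induct [consumes 1, case_names base All]:
  assumes "p \<in> Pi_fm (Suc k)" "\<And>p. p \<in> Sigma_fm k \<Longrightarrow> P p"
    "\<And>p. p \<in> Pi_fm (Suc k) \<Longrightarrow> P p \<Longrightarrow> P (All p)"
  shows "P p"
proof -
  obtain n q where "p = (All ^^ n) q" "q \<in> Sigma_fm k" using assms(1) by auto
  moreover have "(All ^^ n) q \<in> Pi_fm (Suc k) \<and> P ((All ^^ n) q)" if "q \<in> Sigma_fm k" for n q
    using that assms(2,3) Sigma_subset_Pi
    by (induction n) (auto simp del: Pi_fm.simps intro: All_in_Pi)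
  ultimately show ?thesis by blast
qed

declare Sigma_fm.simps(2) [simp del] Pi_fm.simps(2) [simp del]

lemma prenex_Suc: "Sigma_fm k \<subseteq> Sigma_fm (Suc k)" "Pi_fm k \<subseteq> Pi_fm (Suc k)"
proof (induction k)
  case 0
  show "Sigma_fm 0 \<subseteq> Sigma_fm (Suc 0)" "Pi_fm 0 \<subseteq> Pi_fm (Suc 0)"
    using Pi_subset_Sigma[of 0] Sigma_subset_Pi[of 0] by auto
next
  case (Suc k)
  have "p \<in> Sigma_fm (Suc (Suc k))" if "p \<in> Sigma_fm (Suc k)" for p
    using that
  proof (induction rule: Sigma_Suc_induct)
    case (base p)
    then show ?case using Suc Pi_subset_Sigma by blast
  qed (rule Ex_in_Sigma)
  moreover have "p \<in> Pi_fm (Suc (Suc k))" if "p \<in> Pi_fm (Suc k)" for p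
    using that
  proof (induction rule: Pi_Suc_induct)
    case (base p)
    then show ?case using Suc Sigma_subset_Pi by blast
  qed (rule All_in_Pi)
  ultimately show "Sigma_fm (Suc k) \<subseteq> Sigma_fm (Suc (Suc k))"
    "Pi_fm (Suc k) \<subseteq> Pi_fm (Suc (Suc k))" by blast+
qed

lemma qfree_prenex:
  assumes "wf_fm p" "qfree p" shows "p \<in> Sigma_fm k" "p \<in> Pi_fm k"
proof (induction k)
  case (Suc k)
  then show "p \<in> Sigma_fm (Suc k)" "p \<in> Pi_fm (Suc k)" using prenex_Suc by blast+
qed (use assms in simp_all)

lemma wf_prenex: "p \<in> Sigma_fm k \<Longrightarrow> wf_fm p" "p \<in> Pi_fm k \<Longrightarrow> wf_fm p"
proof (induction k arbitrary: p)
  case (Suc k)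
  show "wf_fm p" if "p \<in> Sigma_fm (Suc k)" for p
    using that by (induction rule: Sigma_Suc_induct) (simp_all add: Suc)
  show "wf_fm p" if "p \<in> Pi_fm (Suc k)" for p
    using that by (induction rule: Pi_Suc_induct) (simp_all add: Suc)
qed simp_all

lemma qfree_subst [simp]: "qfree (subst \<sigma> p) = qfree p"
  by (induction p arbitrary: \<sigma>) simp_all

lemma subst_prenex:
  "p \<in> Sigma_fm k \<Longrightarrow> (\<And>n. wf_trm (\<sigma> n)) \<Longrightarrow> subst \<sigma> p \<in> Sigma_fm k"
  "p \<in> Pi_fm k \<Longrightarrow> (\<And>n. wf_trm (\<sigma> n)) \<Longrightarrow> subst \<sigma> p \<in> Pi_fm k"
proof (induction k arbitrary: p \<sigma>)
  case (Suc k)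
  show "subst \<sigma> p \<in> Sigma_fm (Suc k)" if "p \<in> Sigma_fm (Suc k)" "\<And>n. wf_trm (\<sigma> n)" for p \<sigma>
    using that
  proof (induction arbitrary: \<sigma> rule: Sigma_Suc_induct)
    case (base p)
    then show ?case using Suc.IH(2) Pi_subset_Sigma by blast
  next
    case (Ex p)
    then show ?case by (simp add: Ex_in_Sigma wf_under)
  qed
  show "subst \<sigma> p \<in> Pi_fm (Suc k)" if "p \<in> Pi_fm (Suc k)" "\<And>n. wf_trm (\<sigma> n)" for p \<sigma>
    using that
  proof (induction arbitrary: \<sigma> rule: Pi_Suc_induct)
    case (base p)
    then show ?case using Suc.IH(1) Sigma_subset_Pi by blast
  next
    case (All p)
    then show ?case by (simp add: All_in_Pi wf_under)
  qed
qed (simp_all add: wf_subst)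

lemma lift_prenex: "p \<in> Sigma_fm k \<Longrightarrow> lift p \<in> Sigma_fm k" "p \<in> Pi_fm k \<Longrightarrow> lift p \<in> Pi_fm k"
  by (simp_all add: lift_def subst_prenex)

section \<open>Conjunctions of prenex formulas\<close>

lemma conj_Ex_step:
  assumes "equiv_in T (And p (lift q)) r"
  shows "equiv_in T (And (Ex p) q) (Ex r)"
proof -
  have wf: "wf_fm p" "wf_fm q" "wf_fm r"
    using assms by (auto simp: equiv_in_def lift_def dest: wf_of_subst)
  have "deriv T {And (Ex p) q} (Ex r)"
  proof (rule deriv.ExE)
    show "deriv T {And (Ex p) q} (Ex p)" using deriv_hyp[of "And (Ex p) q" T "{}"] wf
      by (simp add: deriv_And)
    have "deriv T {p, lift (And (Ex p) q)} (lift (And (Ex p) q))"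
      using wf wf_lift[of "Ex p"] by (intro deriv.Hyp) auto
    then have "deriv T {p, lift (And (Ex p) q)} (And p (lift q))"
      using wf by (auto simp: deriv_And deriv_hyp)
    then show "deriv T (insert p (lift ` {And (Ex p) q})) (lift (Ex r))"
      using equiv_in_iff[OF assms] deriv_Ex_lift by (simp del: lift_simps)
  qed
  moreover have "deriv T {Ex r} (And (Ex p) q)"
  proof (rule deriv_Ex_left)
    have "deriv T {r} (And p (lift q))" using assms by (simp add: equiv_in_def)
    then show "deriv T {r} (lift (And (Ex p) q))"
      using deriv_Ex_lift by (auto simp: deriv_And)
  qed (rule wf)
  ultimately show ?thesis using wf by (simp add: equiv_in_def)
qed

lemma conj_All_step:
  assumes T: "closed_under_subst T" and "equiv_in T (And p (lift q)) r"
  shows "equiv_in T (And (All p) q) (All r)"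
proof -
  have wf: "wf_fm p" "wf_fm q" "wf_fm r"
    using assms by (auto simp: equiv_in_def lift_def dest: wf_of_subst)
  have "deriv T G (And (All p) q) \<longleftrightarrow> deriv T G (All r)" for G
  proof -
    \<comment> \<open>The fresh variable does not affect q: lift to introduce it, instantiate it at
      \<open>zero\<close> to remove it.\<close>
    have "deriv T G q \<longleftrightarrow> deriv T (lift ` G) (lift q)"
    proof
      assume "deriv T (lift ` G) (lift q)"
      then have "deriv T G (inst (lift q) zero)" by (intro deriv.AllE deriv.AllI) simp_all
      then show "deriv T G q" by simp
    qed (rule deriv_lift[OF T])
    then have "deriv T G (And (All p) q) \<longleftrightarrow> deriv T (lift ` G) (And p (lift q))"
      by (simp add: deriv_And deriv_All[OF T])
    then show ?thesis by (simp add: deriv_All[OF T] equiv_in_iff[OF assms(2)])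
  qed
  then show ?thesis using wf by (simp add: equiv_inI)
qed

lemma equiv_in_And_commute: "wf_fm p \<Longrightarrow> wf_fm q \<Longrightarrow> equiv_in T (And p q) (And q p)"
  by (rule equiv_inI) (auto simp: deriv_And)

text \<open>Quantifiers of either kind leave a conjunction intuitionistically. The block of p is
  pulled out first, then that of q after commuting the conjuncts; two formulas of the dual kind at
  level k remain, and the outer induction hypothesis serves for them. \<open>imp_prenex\<close> has
  the same nesting.\<close>

lemma conj_prenex:
  assumes T: "closed_under_subst T"
  shows "p \<in> Sigma_fm k \<Longrightarrow> q \<in> Sigma_fm k \<Longrightarrow>
      \<exists>r \<in> Sigma_fm k. fv r = fv p \<union> fv q \<and> equiv_in T (And p q) r"
    and "p \<in> Pi_fm k \<Longrightarrow> q \<in> Pi_fm k \<Longrightarrow>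
      \<exists>r \<in> Pi_fm k. fv r = fv p \<union> fv q \<and> equiv_in T (And p q) r"
proof (induction k arbitrary: p q)
  case 0
  {
    case 1 then show ?case by (auto intro!: exI[of _ "And p q"] equiv_in_refl)
  next
    case 2 then show ?case by (auto intro!: exI[of _ "And p q"] equiv_in_refl)
  }
next
  case (Suc k)
  {
    case 1
    then show ?case
    proof (induction arbitrary: q rule: Sigma_Suc_induct)
      case (base p)
      from base(2,1) show ?case
      proof (induction arbitrary: p rule: Sigma_Suc_induct)
        case (base q)
        then show ?case using Suc.IH(2) Pi_subset_Sigma by blast
      next
        case (Ex q)
        obtain r where r: "r \<in> Sigma_fm (Suc k)" "fv r = fv (lift p) \<union> fv q"
          "equiv_in T (And (lift p) q) r"
          using Ex.IH[of "lift p"] lift_prenex Ex.prems by blast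
        have wf: "wf_fm p" "wf_fm q" using wf_prenex Ex by blast+
        have "equiv_in T (And p (Ex q)) (And (Ex q) p)" using wf by (simp add: equiv_in_And_commute)
        also have "equiv_in T (And (Ex q) p) (Ex r)"
          using equiv_in_trans[OF equiv_in_And_commute r(3)] wf by (intro conj_Ex_step) simp
        finally show ?case using r by (auto simp: fv_lift intro!: bexI[OF _ Ex_in_Sigma[OF r(1)]])
      qed
    next
      case (Ex p)
      obtain r where r: "r \<in> Sigma_fm (Suc k)" "fv r = fv p \<union> fv (lift q)"
        "equiv_in T (And p (lift q)) r"
        using Ex.IH[of "lift q"] lift_prenex Ex.prems by blast
      show ?case using r by (auto simp: fv_lift intro!: bexI[OF _ Ex_in_Sigma[OF r(1)]] conj_Ex_step)
    qed
  next
    case 2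
    then show ?case
    proof (induction arbitrary: q rule: Pi_Suc_induct)
      case (base p)
      from base(2,1) show ?case
      proof (induction arbitrary: p rule: Pi_Suc_induct)
        case (base q)
        then show ?case using Suc.IH(1) Sigma_subset_Pi by blast
      next
        case (All q)
        obtain r where r: "r \<in> Pi_fm (Suc k)" "fv r = fv (lift p) \<union> fv q"
          "equiv_in T (And (lift p) q) r"
          using All.IH[of "lift p"] lift_prenex All.prems by blast
        have wf: "wf_fm p" "wf_fm q" using wf_prenex All by blast+
        have "equiv_in T (And p (All q)) (And (All q) p)" using wf by (simp add: equiv_in_And_commute)
        also have "equiv_in T (And (All q) p) (All r)"
          using equiv_in_trans[OF equiv_in_And_commute r(3)] wf by (intro conj_All_step[OF T]) simp
        finally show ?case using r by (auto simp: fv_lift intro!: bexI[OF _ All_in_Pi[OF r(1)]])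
      qed
    next
      case (All p)
      obtain r where r: "r \<in> Pi_fm (Suc k)" "fv r = fv p \<union> fv (lift q)"
        "equiv_in T (And p (lift q)) r"
        using All.IH[of "lift q"] lift_prenex All.prems by blast
      show ?case using r by (auto simp: fv_lift intro!: bexI[OF _ All_in_Pi[OF r(1)]] conj_All_step[OF T])
    qed
  }
qed

section \<open>Implications between prenex formulas\<close>

text \<open>This relation is what prenexing \<open>p \<rightarrow> q\<close> to a \<open>\<Sigma>\<^sub>k\<close> formula achieves without double negation
  elimination for \<open>\<Sigma>\<^sub>k\<close> itself.\<close>

definition weakly_equiv :: "fm set \<Rightarrow> fm \<Rightarrow> fm \<Rightarrow> bool" where
  "weakly_equiv T p r \<longleftrightarrow> wf_fm p \<and> wf_fm r \<and> deriv T {r} p \<and> deriv T {Neg r} (Neg p)"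

lemma deriv_of_lift_All:
  assumes "deriv T G (lift (All p))" shows "deriv T G p"
proof -
  have "deriv T G (inst (subst (under (\<lambda>n. Var (Suc n))) p) (Var 0))"
    using assms by (intro deriv.AllE) simp_all
  then show ?thesis by (simp add: inst_subst_under)
qed

lemma deriv_Neg_of_Neg_lift_Ex:
  assumes "wf_fm r" "deriv T G (Neg (lift (Ex r)))"
  shows "deriv T G (Neg r)"
proof (rule deriv.ImpI)
  show "deriv T (insert r G) Fls"
  proof (rule deriv.ImpE)
    show "deriv T (insert r G) (Neg (lift (Ex r)))" by (rule deriv_mono[OF assms(2)]) auto
    show "deriv T (insert r G) (lift (Ex r))" by (rule deriv_Ex_lift[OF deriv_hyp[OF assms(1)]])
  qed
qed (rule assms(1))

lemma deriv_vacuous_Imp: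
  "wf_fm p \<Longrightarrow> wf_fm q \<Longrightarrow> deriv T G (Neg p) \<Longrightarrow> deriv T G (Imp p q)"
  by (auto simp: deriv_Imp intro: deriv.FlsE[of T _ q])

lemma equiv_in_weakly_equiv:
  assumes "equiv_in T p q" shows "weakly_equiv T p q"
proof -
  have "equiv_in T (Neg q) (Neg p)"
    by (intro equiv_in_Imp equiv_in_sym[OF assms] equiv_in_refl) simp
  then show ?thesis using assms by (simp add: equiv_in_def weakly_equiv_def)
qed

text \<open>If p held together with \<not>r, weak equivalence would give \<not>p; so p yields
  \<not>\<not>r, and stability does the rest.\<close>

lemma weakly_equiv_stable:
  assumes "weakly_equiv T p r" "stable T r"
  shows "equiv_in T p r"
proof -
  have wf: "wf_fm p" "wf_fm r" using assms by (simp_all add: weakly_equiv_def)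
  have "deriv T {p} (Neg (Neg r))"
  proof (rule deriv.ImpI)
    have "deriv T {Neg r, p} (Neg p)"
      by (rule deriv_mono[of _ "{Neg r}"]) (use assms in \<open>auto simp: weakly_equiv_def\<close>)
    moreover have "deriv T {Neg r, p} p" using wf by (intro deriv.Hyp) auto
    ultimately show "deriv T {Neg r, p} Fls" by (rule deriv.ImpE)
  qed (use wf in simp)
  then have "deriv T {p} r" by (rule deriv_stable[OF assms(2)])
  then show ?thesis using assms by (simp add: equiv_in_def weakly_equiv_def)
qed

text \<open>Suppose \<forall>x p \<rightarrow> q while no x satisfies p \<rightarrow> q. Then
  \<not>\<not>p for every x, since \<not>p would make the implication vacuously true. Stability
  turns this into \<forall>x p, whence q, whence p \<rightarrow> q after all. Stability of p thus
  replaces the classical choice of a counterexample to \<forall>x p.\<close>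

lemma imp_All_step:
  assumes T: "closed_under_subst T" and p: "stable T p"
    and r: "weakly_equiv T (Imp p (lift q)) r" and q: "wf_fm q"
  shows "weakly_equiv T (Imp (All p) q) (Ex r)"
proof -
  have wf: "wf_fm p" "wf_fm r" using r by (simp_all add: weakly_equiv_def)
  have r1: "deriv T {r} (Imp p (lift q))" and r2: "deriv T {Neg r} (Neg (Imp p (lift q)))"
    using r by (simp_all add: weakly_equiv_def)
  have "deriv T {Ex r} (Imp (All p) q)"
  proof (rule deriv_Ex_left)
    have "deriv T H (lift q)" if "{r} \<subseteq> H" "deriv T H (lift (All p))" for H
      by (rule deriv.ImpE[OF deriv_mono[OF r1 that(1)] deriv_of_lift_All[OF that(2)]])
    then show "deriv T {r} (lift (Imp (All p) q))"
      using wf_lift[of "All p"] wf unfolding lift_simps(5) by (subst deriv_Imp) auto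
  qed (rule wf)
  moreover have "deriv T {Neg (Ex r)} (Neg (Imp (All p) q))"
  proof (rule deriv.ImpI)
    let ?G = "{Imp (All p) q, Neg (Ex r)}"
    have "deriv T (lift ` ?G) (lift (Neg (Ex r)))"
      using wf by (intro deriv_lift[OF T] deriv.Hyp) auto
    then have "deriv T (lift ` ?G) (Neg r)"
      unfolding lift_simps(2,5) by (rule deriv_Neg_of_Neg_lift_Ex[OF wf(2)])
    then have N: "deriv T (lift ` ?G) (Neg (Imp p (lift q)))"
      by (rule deriv_cut[OF r2, rotated]) (use wf in simp)
    have "deriv T (lift ` ?G) (Neg (Neg p))"
    proof (rule deriv.ImpI)
      have "deriv T (insert (Neg p) (lift ` ?G)) (Neg (Imp p (lift q)))"
        by (rule deriv_mono[OF N]) auto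
      moreover have "deriv T (insert (Neg p) (lift ` ?G)) (Imp p (lift q))"
        using wf q by (intro deriv_vacuous_Imp[OF _ _ deriv_hyp]) simp_all
      ultimately show "deriv T (insert (Neg p) (lift ` ?G)) Fls" by (rule deriv.ImpE)
    qed (use wf in simp)
    then have "deriv T (lift ` ?G) p" by (rule deriv_stable[OF p])
    then have "deriv T ?G (All p)" by (rule deriv.AllI)
    moreover have "deriv T ?G (Imp (All p) q)" using wf q by (intro deriv.Hyp) auto
    ultimately have "deriv T ?G q" by (rule deriv.ImpE[rotated])
    then have "deriv T (lift ` ?G) (lift q)" by (rule deriv_lift[OF T])
    then have "deriv T (insert p (lift ` ?G)) (lift q)" by (rule deriv_mono) auto
    then have "deriv T (lift ` ?G) (Imp p (lift q))" using wf(1) by (rule deriv.ImpI)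
    then have "deriv T (lift ` ?G) Fls" by (rule deriv.ImpE[OF N])
    then show "deriv T ?G Fls" by (rule deriv_lift_Fls)
  qed (use wf q in simp)
  ultimately show ?thesis using wf q by (simp add: weakly_equiv_def)
qed

text \<open>Independence of premise, below a double negation. If no x satisfies p \<rightarrow> q,
  then p is refuted, because p would give a witness of q and with it p \<rightarrow> q; but then p
  \<rightarrow> q holds vacuously.\<close>

lemma imp_Ex_step:
  assumes T: "closed_under_subst T"
    and r: "weakly_equiv T (Imp (lift p) q) r" and p: "wf_fm p"
  shows "weakly_equiv T (Imp p (Ex q)) (Ex r)"
proof -
  have wf: "wf_fm q" "wf_fm r" using r by (simp_all add: weakly_equiv_def)
  have r1: "deriv T {r} (Imp (lift p) q)" and r2: "deriv T {Neg r} (Neg (Imp (lift p) q))"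
    using r by (simp_all add: weakly_equiv_def)
  have "deriv T {Ex r} (Imp p (Ex q))"
  proof (rule deriv_Ex_left)
    have "deriv T H (lift (Ex q))" if "{r} \<subseteq> H" "deriv T H (lift p)" for H
      by (rule deriv_Ex_lift[OF deriv.ImpE[OF deriv_mono[OF r1 that(1)] that(2)]])
    then show "deriv T {r} (lift (Imp p (Ex q)))"
      using p unfolding lift_simps(5) by (simp add: deriv_Imp del: lift_simps)
  qed (rule wf)
  moreover have "deriv T {Neg (Ex r)} (Neg (Imp p (Ex q)))"
  proof (rule deriv.ImpI)
    let ?G = "{Imp p (Ex q), Neg (Ex r)}"
    have "deriv T (lift ` ?G) (lift (Neg (Ex r)))"
      using wf by (intro deriv_lift[OF T] deriv.Hyp) auto
    then have "deriv T (lift ` ?G) (Neg r)"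
      unfolding lift_simps(2,5) by (rule deriv_Neg_of_Neg_lift_Ex[OF wf(2)])
    then have N: "deriv T (lift ` ?G) (Neg (Imp (lift p) q))"
      by (rule deriv_cut[OF r2, rotated]) (use wf in simp)
    have "deriv T ?G (Neg p)"
    proof (rule deriv.ImpI)
      show "deriv T (insert p ?G) Fls"
      proof (rule deriv.ExE)
        show "deriv T (insert p ?G) (Ex q)"
          using p wf by (intro deriv.ImpE[of _ _ p "Ex q"] deriv.Hyp) auto
        have "deriv T (insert q (lift ` insert p ?G)) (Imp (lift p) q)"
          using p wf by (intro deriv.ImpI deriv.Hyp) auto
        moreover have "deriv T (insert q (lift ` insert p ?G)) (Neg (Imp (lift p) q))"
          by (rule deriv_mono[OF N]) auto
        ultimately show "deriv T (insert q (lift ` insert p ?G)) (lift Fls)"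
          by (auto intro: deriv.ImpE)
      qed
    qed (rule p)
    then have "deriv T (lift ` ?G) (lift (Neg p))" by (rule deriv_lift[OF T])
    then have "deriv T (lift ` ?G) (Neg (lift p))" unfolding lift_simps(2,5) .
    then have "deriv T (lift ` ?G) (Imp (lift p) q)"
      by (rule deriv_vacuous_Imp[rotated 2]) (use wf p in simp_all)
    then have "deriv T (lift ` ?G) Fls" by (rule deriv.ImpE[OF N])
    then show "deriv T ?G Fls" by (rule deriv_lift_Fls)
  qed (use wf p in simp)
  ultimately show ?thesis using wf p by (simp add: weakly_equiv_def)
qed

text \<open>The moves that give an implication a universal prefix, here and in
  \<open>imp_All_right_step\<close>, are valid intuitionistically and hence keep full
  equivalence.\<close>

lemma Ex_imp_step:
  assumes r: "equiv_in T (Imp p (lift q)) r" and q: "wf_fm q"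
  shows "equiv_in T (Imp (Ex p) q) (All r)"
proof -
  have wf: "wf_fm p" "wf_fm r" using r by (simp_all add: equiv_in_def)
  have "deriv T {Imp (Ex p) q} (All r)"
  proof (rule deriv.AllI)
    let ?G = "{lift (Imp (Ex p) q)}"
    have "deriv T ?G (lift (Imp (Ex p) q))"
      using wf q wf_lift[of "Imp (Ex p) q"] by (intro deriv_hyp) auto
    then have "deriv T ?G (Imp p (lift q))"
      using wf wf_lift[of "Ex p"] deriv_Ex_lift[of T _ p] unfolding lift_simps(5)
      by (simp add: deriv_Imp del: lift_simps)
    then show "deriv T (lift ` {Imp (Ex p) q}) r" by (simp add: equiv_in_iff[OF r] del: lift_simps)
  qed
  moreover have "deriv T {All r} (Imp (Ex p) q)"
  proof (rule deriv.ImpI, rule deriv.ExE)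
    show "deriv T {Ex p, All r} (Ex p)" using wf by (intro deriv.Hyp) auto
    let ?G = "insert p (lift ` {Ex p, All r})"
    have "deriv T ?G (lift (All r))"
      using wf wf_lift[of "All r"] by (intro deriv.Hyp) auto
    then have "deriv T ?G (Imp p (lift q))"
      unfolding equiv_in_iff[OF r] by (rule deriv_of_lift_All)
    then show "deriv T ?G (lift q)" by (rule deriv.ImpE) (use wf in \<open>simp add: deriv_hyp\<close>)
  qed (use wf in simp)
  ultimately show ?thesis using wf q by (simp add: equiv_in_def)
qed

lemma imp_All_right_step:
  assumes r: "equiv_in T (Imp (lift p) q) r" and p: "wf_fm p"
  shows "equiv_in T (Imp p (All q)) (All r)"
proof -
  have wf: "wf_fm q" "wf_fm r" using r by (simp_all add: equiv_in_def)
  have "deriv T {Imp p (All q)} (All r)"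
  proof (rule deriv.AllI)
    let ?G = "{lift (Imp p (All q))}"
    have "deriv T ?G (lift (Imp p (All q)))"
      using wf p wf_lift[of "Imp p (All q)"] by (intro deriv_hyp) auto
    then have "deriv T ?G (Imp (lift p) q)"
      using p deriv_of_lift_All[of T _ q] unfolding lift_simps(5)
      by (simp add: deriv_Imp del: lift_simps)
    then show "deriv T (lift ` {Imp p (All q)}) r" by (simp add: equiv_in_iff[OF r] del: lift_simps)
  qed
  moreover have "deriv T {All r} (Imp p (All q))"
  proof (intro deriv.ImpI deriv.AllI)
    let ?G = "lift ` {p, All r}"
    have "deriv T ?G (lift (All r))"
      using wf wf_lift[of "All r"] by (intro deriv.Hyp) auto
    then have "deriv T ?G (Imp (lift p) q)"
      unfolding equiv_in_iff[OF r] by (rule deriv_of_lift_All)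
    then show "deriv T ?G q" by (rule deriv.ImpE) (use p in \<open>simp add: deriv.Hyp\<close>)
  qed (rule p)
  ultimately show ?thesis using wf p by (simp add: equiv_in_def)
qed

section \<open>Stability of prenex formulas\<close>

text \<open>These are the theories T of the overview. The index exceeds that of the schema by one:
  level 0 is plain HA, and \<open>DNE_theory (Suc k)\<close> has the schema for \<Sigma>_k.\<close>

definition DNE_theory :: "nat \<Rightarrow> fm set" where
  "DNE_theory k = (if k = 0 then HA else HA \<union> DNE (Sigma_fm (k - 1)))"

lemma DNE_theory_simps: "DNE_theory 0 = HA" "DNE_theory (Suc k) = HA \<union> DNE (Sigma_fm k)"
  by (simp_all add: DNE_theory_def)

lemma HA_subset_DNE_theory: "HA \<subseteq> DNE_theory k"
  by (simp add: DNE_theory_def)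

lemma DNE_theory_Suc: "DNE_theory k \<subseteq> DNE_theory (Suc k)"
  using prenex_Suc(1) by (cases k) (auto simp: DNE_theory_simps DNE_def)

text \<open>An instance of \<open>DNE\<close> has its one parameter bound and is a sentence, so
  substitution fixes it.\<close>

lemma closed_DNE_theory: "closed_under_subst (DNE_theory k)"
proof -
  have "subst \<sigma> p = p" if "p \<in> DNE A" for p A \<sigma>
  proof (rule subst_ident)
    fix n assume "n \<in> fv p"
    then show "\<sigma> n = Var n" using that by (auto simp: DNE_def)
  qed
  then have "closed_under_subst (HA \<union> DNE A)" for A
    using closed_HA by (auto simp: closed_under_subst_def)
  then show ?thesis using closed_HA by (simp add: DNE_theory_def)
qed

section \<open>Decidability of quantifier-free formulas\<close>

lemma qfree_decidable: "wf_fm p \<Longrightarrow> qfree p \<Longrightarrow> deriv HA G (Or p (Neg p))"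
proof (induction p arbitrary: G)
  case (Eq s t)
  then show ?case by (simp add: eq_decidable)
next
  case Fls
  show ?case by (intro deriv.OrI2 deriv.ImpI deriv.Hyp) simp_all
next
  case (And p q)
  then have wf: "wf_fm p" "wf_fm q" by simp_all
  have dec: "deriv HA G (Or p (Neg p))" "deriv HA G (Or q (Neg q))" for G using And by simp_all
  show ?case
  proof (rule deriv.OrE[OF dec(1)])
    show "deriv HA (insert p G) (Or (And p q) (Neg (And p q)))"
    proof (rule deriv.OrE[OF dec(2)])
      show "deriv HA (insert q (insert p G)) (Or (And p q) (Neg (And p q)))"
        using wf by (intro deriv.OrI1 deriv.AndI deriv.Hyp) auto
      have "deriv HA (insert (Neg q) (insert p G)) (Neg q)" using wf by (simp add: deriv_hyp)
      then show "deriv HA (insert (Neg q) (insert p G)) (Or (And p q) (Neg (And p q)))"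
        using wf by (intro deriv.OrI2) (simp_all add: deriv_Imp deriv_And)
    qed
    have "deriv HA (insert (Neg p) G) (Neg p)" using wf by (simp add: deriv_hyp)
    then show "deriv HA (insert (Neg p) G) (Or (And p q) (Neg (And p q)))"
      using wf by (intro deriv.OrI2) (simp_all add: deriv_Imp deriv_And)
  qed
next
  case (Or p q)
  then have wf: "wf_fm p" "wf_fm q" by simp_all
  have dec: "deriv HA G (Or p (Neg p))" "deriv HA G (Or q (Neg q))" for G using Or by simp_all
  show ?case
  proof (rule deriv.OrE[OF dec(1)])
    show "deriv HA (insert p G) (Or (Or p q) (Neg (Or p q)))"
      using wf by (intro deriv.OrI1 deriv.Hyp) auto
    show "deriv HA (insert (Neg p) G) (Or (Or p q) (Neg (Or p q)))"
    proof (rule deriv.OrE[OF dec(2)])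
      show "deriv HA (insert q (insert (Neg p) G)) (Or (Or p q) (Neg (Or p q)))"
        using wf by (intro deriv.OrI1[of _ _ "Or p q"] deriv.OrI2[of _ _ q] deriv.Hyp) auto
      let ?G = "insert (Neg q) (insert (Neg p) G)"
      have "deriv HA (insert (Or p q) ?G) Fls"
      proof (rule deriv.OrE)
        show "deriv HA (insert (Or p q) ?G) (Or p q)" using wf by (simp add: deriv_hyp)
        show "deriv HA (insert p (insert (Or p q) ?G)) Fls"
          by (rule deriv.ImpE[of _ _ p]; rule deriv.Hyp) (use wf in auto)
        show "deriv HA (insert q (insert (Or p q) ?G)) Fls"
          by (rule deriv.ImpE[of _ _ q]; rule deriv.Hyp) (use wf in auto)
      qed
      then show "deriv HA ?G (Or (Or p q) (Neg (Or p q)))"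
        using wf by (intro deriv.OrI2 deriv.ImpI) simp_all
    qed
  qed
next
  case (Imp p q)
  then have wf: "wf_fm p" "wf_fm q" by simp_all
  have dec: "deriv HA G (Or p (Neg p))" "deriv HA G (Or q (Neg q))" for G using Imp by simp_all
  show ?case
  proof (rule deriv.OrE[OF dec(1)])
    show "deriv HA (insert p G) (Or (Imp p q) (Neg (Imp p q)))"
    proof (rule deriv.OrE[OF dec(2)])
      show "deriv HA (insert q (insert p G)) (Or (Imp p q) (Neg (Imp p q)))"
        using wf by (intro deriv.OrI1 deriv.ImpI deriv.Hyp) auto
      let ?G = "insert (Imp p q) (insert (Neg q) (insert p G))"
      have "deriv HA ?G q" by (rule deriv.ImpE[of _ _ p]; rule deriv.Hyp) (use wf in auto)
      moreover have "deriv HA ?G (Neg q)" using wf by (intro deriv.Hyp) auto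
      ultimately show "deriv HA (insert (Neg q) (insert p G)) (Or (Imp p q) (Neg (Imp p q)))"
        using wf by (intro deriv.OrI2 deriv.ImpI) (auto intro: deriv.ImpE)
    qed
    have "deriv HA (insert (Neg p) G) (Imp p q)"
      using wf by (intro deriv_vacuous_Imp[OF _ _ deriv_hyp]) simp_all
    then show "deriv HA (insert (Neg p) G) (Or (Imp p q) (Neg (Imp p q)))"
      using wf by (intro deriv.OrI1) simp_all
  qed
qed simp_all

lemma stable_qfree:
  assumes "wf_fm p" "qfree p" shows "stable HA p"
proof -
  have "deriv HA {Neg (Neg p)} p"
  proof (rule deriv.OrE[OF qfree_decidable[OF assms]])
    show "deriv HA {p, Neg (Neg p)} p" using assms by (simp add: deriv_hyp)
    have "deriv HA {Neg p, Neg (Neg p)} Fls"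
      by (rule deriv.ImpE[of _ _ "Neg p"]; rule deriv.Hyp) (use assms in auto)
    then show "deriv HA {Neg p, Neg (Neg p)} p" using assms(1) by (rule deriv.FlsE)
  qed
  then show ?thesis using assms by (simp add: stable_def deriv.ImpI)
qed

text \<open>Two free variables \<open>x, y\<close> of \<open>p\<close> are merged into one variable \<open>z\<close>: stability of
  \<open>\<exists>x y. z = \<langle>x, y\<rangle> \<and> p\<close>, which has a prenex form of the same complexity, gives stability of \<open>p\<close>
  upon substituting \<open>\<langle>x, y\<rangle>\<close> for \<open>z\<close>.\<close>

lemma equiv_coded:
  assumes "wf_fm p"
  shows "equiv_in HA
    (subst (case_nat (Fn pair [Var 0, Var (Suc 0)]) (\<lambda>n. Var (Suc (Suc n))))
      (Ex (Ex (And (Eq (Var (Suc (Suc 0))) (Fn pair [Var 0, Var (Suc 0)]))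
        (subst (case_nat (Var 0) (case_nat (Var (Suc 0)) (\<lambda>n. Var (Suc (Suc (Suc n)))))) p)))))
    p"
    (is "equiv_in HA ?x p")
proof -
  \<comment> \<open>\<open>?r s t k\<close> is p with variables s and t for its variables 0 and 1,
    and with variable n + k for its variable n + 2. At k = 4 this is p below two binders, where the
    outer variables 0 and 1 are called 2 and 3; k = 5 leaves room for the mark of a replacement
    template.\<close>
  let ?r = "\<lambda>s t k. subst (case_nat (Var s) (case_nat (Var t) (\<lambda>n. Var (n + k)))) p"
  define X where "X = And (Eq (Fn pair [Var 2, Var 3]) (Fn pair [Var 0, Var 1])) (?r 0 1 4)"
  have wf: "wf_fm X" using assms by (auto simp: X_def intro!: wf_subst split: nat.split)
  have x: "?x = Ex (Ex X)"
    by (simp add: X_def subst_comp numeral_eq_Suc)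
       (rule subst_cong, auto split: nat.split)
  have "deriv HA {X} (lift (lift p))"
  proof -
    have "deriv HA {X} X" using wf by (rule deriv_hyp)
    then have e: "deriv HA {X} (Eq (Fn pair [Var 2, Var 3]) (Fn pair [Var 0, Var 1]))"
      and p: "deriv HA {X} (?r 0 1 4)" by (simp_all add: X_def deriv_And)
    have inst0: "inst (?r 0 (Suc t) 5) (Var s) = ?r s t 4" for s t
      unfolding inst_def subst_comp by (rule subst_cong) (auto split: nat.split)
    have inst1: "inst (?r (Suc s) 0 5) (Var t) = ?r s t 4" for s t
      unfolding inst_def subst_comp by (rule subst_cong) (auto split: nat.split)
    \<comment> \<open>By injectivity the bound pair 0, 1 equals the outer pair 2, 3; the coordinates
      are exchanged one after the other.\<close>
    have "deriv HA {X} (?r 2 1 4)"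
      using HA_replace[OF HA_sym[OF pair_inj(1)[OF e]], of "?r 0 (Suc 1) 5"] p
      unfolding inst0 by simp
    then have "deriv HA {X} (?r 2 3 4)"
      using HA_replace[OF HA_sym[OF pair_inj(2)[OF e]], of "?r (Suc 2) 0 5"]
      unfolding inst1 by simp
    moreover have "?r 2 3 4 = lift (lift p)"
      unfolding lift_def subst_comp
      by (rule subst_cong) (auto simp: numeral_eq_Suc split: nat.split)
    ultimately show ?thesis by simp
  qed
  then have "deriv HA {Ex (Ex X)} p" using wf by (auto intro!: deriv_Ex_left)
  moreover have "deriv HA {p} (Ex (Ex X))"
  proof (rule deriv.ExI)
    have "subst (case_nat (Var 0) (case_nat (Var 1) Var)) X =
        And (Eq (Fn pair [Var 0, Var 1]) (Fn pair [Var 0, Var 1])) p"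
      unfolding X_def subst.simps subst_comp
      by (auto simp: numeral_eq_Suc split: nat.split intro!: subst_ident)
    then have "deriv HA {p} (subst (case_nat (Var 0) (case_nat (Var 1) Var)) X)"
      using assms by (simp add: deriv_And HA_refl deriv_hyp)
    then have "deriv HA {p} (Ex (subst (under (case_nat (Var 1) Var)) X))"
      by (intro deriv.ExI[where t = "Var 0"]) (simp_all add: inst_subst_under)
    then show "deriv HA {p} (inst (Ex X) (Var 1))" by (simp add: inst_def)
  qed simp
  ultimately show ?thesis unfolding x using wf assms by (simp add: equiv_in_def)
qed

text \<open>Induction on the bound n for the free variables. With at most one variable this is an
  instance of the schema; otherwise variables 0 and 1 are merged and the bound drops by one. The
  level is a successor because the two new existential quantifiers must be absorbed.\<close>

lemma stable_Sigma_bounded: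
  "p \<in> Sigma_fm (Suc k) \<Longrightarrow> fv p \<subseteq> {..<n} \<Longrightarrow> stable (DNE_theory (Suc (Suc k))) p"
proof (induction n arbitrary: p rule: less_induct)
  case (less n)
  let ?T = "DNE_theory (Suc (Suc k))"
  have wf: "wf_fm p" using less.prems wf_prenex by blast
  show ?case
  proof (cases "n \<le> 1")
    case True
    then have "fv p \<subseteq> {0}" using less.prems by (auto simp: subset_iff)
    then have "All (Imp (Neg (Neg p)) p) \<in> ?T"
      using less.prems by (auto simp: DNE_theory_simps DNE_def)
    then have "?T \<turnstile> All (Imp (Neg (Neg p)) p)" by (rule deriv.Ax)
    then show ?thesis using wf by (simp add: stable_def deriv_All[OF closed_DNE_theory])
  next
    case False
    then obtain m where n: "n = Suc (Suc m)"
      by (metis One_nat_def Suc_le_mono not0_implies_Suc le0)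
    let ?\<rho> = "case_nat (Var 0) (case_nat (Var (Suc 0)) (\<lambda>n. Var (Suc (Suc (Suc n)))))"
    let ?e = "Eq (Var (Suc (Suc 0))) (Fn pair [Var 0, Var (Suc 0)])"
    have "?e \<in> Sigma_fm (Suc k)" by (rule qfree_prenex) simp_all
    moreover have "subst ?\<rho> p \<in> Sigma_fm (Suc k)"
      by (rule subst_prenex(1)[OF less.prems(1)]) (auto split: nat.split)
    ultimately obtain r where r: "r \<in> Sigma_fm (Suc k)" "fv r = fv ?e \<union> fv (subst ?\<rho> p)"
      "equiv_in HA (And ?e (subst ?\<rho> p)) r"
      using conj_prenex(1)[OF closed_HA] by blast
    have "stable ?T (Ex (Ex r))"
    proof (rule less.IH)
      show "Suc m < n" using n by simp
      show "Ex (Ex r) \<in> Sigma_fm (Suc k)" using r by (simp add: Ex_in_Sigma)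
      show "fv (Ex (Ex r)) \<subseteq> {..<Suc m}"
      proof
        fix x assume "x \<in> fv (Ex (Ex r))"
        \<comment> \<open>A variable i \<ge> 2 of p is moved to i + 1 and appears as i - 1 outside
          the two quantifiers, where variable 0 is the code z.\<close>
        moreover have "i = Suc x" if "Suc (Suc x) \<in> fv_trm (?\<rho> i)" for i
          using that by (cases i; cases "i - 1") auto
        ultimately have "x = 0 \<or> Suc x \<in> fv p" by (auto simp: r fv_subst)
        then show "x \<in> {..<Suc m}" using less.prems(2) n by auto
      qed
    qed
    moreover have "equiv_in ?T (Ex (Ex r)) (Ex (Ex (And ?e (subst ?\<rho> p))))"
      using equiv_in_mono[OF r(3) HA_subset_DNE_theory] equiv_in_sym equiv_in_Ex by blast
    ultimately have "stable ?T (Ex (Ex (And ?e (subst ?\<rho> p))))" by (rule stable_equiv_in)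
    then have "stable ?T (subst (case_nat (Fn pair [Var 0, Var (Suc 0)]) (\<lambda>n. Var (Suc (Suc n))))
        (Ex (Ex (And ?e (subst ?\<rho> p)))))"
      by (rule stable_subst[OF closed_DNE_theory]) (auto split: nat.split)
    then show ?thesis
      by (rule stable_equiv_in) (rule equiv_in_mono[OF equiv_coded[OF wf] HA_subset_DNE_theory])
  qed
qed

lemma finite_fv_trm: "finite (fv_trm t)"
  by (induction t) auto

lemma finite_fv: "finite (fv p)"
proof (induction p)
  case (All p)
  have "{n. Suc n \<in> fv p} = Suc -` fv p" by auto
  then show ?case using All by (simp add: finite_vimageI)
next
  case (Ex p)
  have "{n. Suc n \<in> fv p} = Suc -` fv p" by auto
  then show ?case using Ex by (simp add: finite_vimageI)
qed (simp_all add: finite_fv_trm)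

lemma stable_Sigma:
  assumes "p \<in> Sigma_fm k" shows "stable (DNE_theory (Suc k)) p"
proof (cases k)
  case 0
  then show ?thesis using assms stable_qfree stable_mono[OF _ HA_subset_DNE_theory] by simp
next
  case (Suc j)
  obtain n where "fv p \<subseteq> {..<n}" using finite_fv[of p] by (auto simp: finite_nat_set_iff_bounded)
  then show ?thesis using assms stable_Sigma_bounded Suc by blast
qed

text \<open>Universal quantifiers preserve stability, so a \<Pi>_k formula needs no more than its
  \<Sigma>_(k-1) matrix, for which \<open>DNE_theory k\<close> has the schema. For k = 0
  decidability is enough.\<close>

lemma stable_Pi:
  assumes "p \<in> Pi_fm k" shows "stable (DNE_theory k) p"
proof (cases k)
  case 0
  then show ?thesis using assms stable_qfree by (simp add: DNE_theory_simps)
next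
  case (Suc j)
  have "stable (DNE_theory (Suc j)) p" if "p \<in> Pi_fm (Suc j)" for p
    using that
    by (induction rule: Pi_Suc_induct) (auto intro: stable_Sigma stable_All closed_DNE_theory)
  then show ?thesis using assms Suc by blast
qed

text \<open>The first half claims only weak equivalence because stability of its \<Sigma>_k result
  is guaranteed just one theory higher. Each half rests on the other one level down.\<close>

lemma imp_prenex:
  shows "p \<in> Pi_fm k \<Longrightarrow> q \<in> Sigma_fm k \<Longrightarrow>
      \<exists>r \<in> Sigma_fm k. fv r = fv p \<union> fv q \<and> weakly_equiv (DNE_theory k) (Imp p q) r"
    and "p \<in> Sigma_fm k \<Longrightarrow> q \<in> Pi_fm k \<Longrightarrow>
      \<exists>r \<in> Pi_fm k. fv r = fv p \<union> fv q \<and> equiv_in (DNE_theory k) (Imp p q) r"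
proof (induction k arbitrary: p q)
  case 0
  {
    case 1
    then show ?case by (auto intro!: exI[of _ "Imp p q"] equiv_in_weakly_equiv equiv_in_refl)
  next
    case 2
    then show ?case by (auto intro!: exI[of _ "Imp p q"] equiv_in_refl)
  }
next
  case (Suc k)
  let ?T = "DNE_theory (Suc k)"
  {
    case 1
    then show ?case
    proof (induction arbitrary: q rule: Pi_Suc_induct)
      case (base p)
      from base(2,1) show ?case
      proof (induction arbitrary: p rule: Sigma_Suc_induct)
        case (base q)
        obtain r where "r \<in> Pi_fm k" "fv r = fv p \<union> fv q" "equiv_in (DNE_theory k) (Imp p q) r"
          using Suc.IH(2)[of p q] base by blast
        then show ?case
          using equiv_in_weakly_equiv[OF equiv_in_mono[OF _ DNE_theory_Suc]] Pi_subset_Sigma by blast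
      next
        case (Ex q)
        obtain r where r: "r \<in> Sigma_fm (Suc k)" "fv r = fv (lift p) \<union> fv q"
          "weakly_equiv ?T (Imp (lift p) q) r"
          using Ex.IH[of "lift p"] lift_prenex Ex.prems by blast
        have "weakly_equiv ?T (Imp p (Ex q)) (Ex r)"
          using Ex.prems wf_prenex by (intro imp_Ex_step[OF closed_DNE_theory r(3)]) blast
        then show ?case using r by (auto simp: fv_lift intro!: bexI[OF _ Ex_in_Sigma[OF r(1)]])
      qed
    next
      case (All p)
      obtain r where r: "r \<in> Sigma_fm (Suc k)" "fv r = fv p \<union> fv (lift q)"
        "weakly_equiv ?T (Imp p (lift q)) r"
        using All.IH[of "lift q"] lift_prenex All.prems by blast
      \<comment> \<open>The body p is again \<Pi>_(k+1), hence stable in this same theory, as the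
        classical step requires.\<close>
      have "weakly_equiv ?T (Imp (All p) q) (Ex r)"
        using All.prems wf_prenex
        by (intro imp_All_step[OF closed_DNE_theory stable_Pi[OF All.hyps(1)] r(3)]) blast
      then show ?case using r by (auto simp: fv_lift intro!: bexI[OF _ Ex_in_Sigma[OF r(1)]])
    qed
  next
    case 2
    then show ?case
    proof (induction arbitrary: q rule: Sigma_Suc_induct)
      case (base p)
      from base(2,1) show ?case
      proof (induction arbitrary: p rule: Pi_Suc_induct)
        case (base q)
        obtain r where r: "r \<in> Sigma_fm k" "fv r = fv p \<union> fv q"
          "weakly_equiv (DNE_theory k) (Imp p q) r"
          using Suc.IH(1)[of p q] base by blast
        have "weakly_equiv ?T (Imp p q) r"
          using r(3) deriv_mono_axioms[OF _ DNE_theory_Suc] by (simp add: weakly_equiv_def)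
        then have "equiv_in ?T (Imp p q) r" using stable_Sigma[OF r(1)] by (rule weakly_equiv_stable)
        then show ?case using r Sigma_subset_Pi by blast
      next
        case (All q)
        obtain r where r: "r \<in> Pi_fm (Suc k)" "fv r = fv (lift p) \<union> fv q"
          "equiv_in ?T (Imp (lift p) q) r"
          using All.IH[of "lift p"] lift_prenex All.prems by blast
        have "equiv_in ?T (Imp p (All q)) (All r)"
          using All.prems wf_prenex by (intro imp_All_right_step[OF r(3)]) blast
        then show ?case using r by (auto simp: fv_lift intro!: bexI[OF _ All_in_Pi[OF r(1)]])
      qed
    next
      case (Ex p)
      obtain r where r: "r \<in> Pi_fm (Suc k)" "fv r = fv p \<union> fv (lift q)"
        "equiv_in ?T (Imp p (lift q)) r"
        using Ex.IH[of "lift q"] lift_prenex Ex.prems by blast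
      have "equiv_in ?T (Imp (Ex p) q) (All r)"
        using Ex.prems wf_prenex by (intro Ex_imp_step[OF r(3)]) blast
      then show ?case using r by (auto simp: fv_lift intro!: bexI[OF _ All_in_Pi[OF r(1)]])
    qed
  }
qed

section \<open>Alternation paths\<close>

lemma finite_prefix_sign: "finite A \<Longrightarrow> finite (prefix_sign c A)"
  by (auto simp: prefix_sign_def setcompr_eq_image)

lemma finite_Alt: "finite (Alt p)"
  by (induction p) (simp_all add: finite_prefix_sign)

lemma Alt_nonempty: "Alt p \<noteq> {}"
  by (induction p) (auto simp: prefix_sign_def)

lemma Nil_notin_prefix_sign: "[] \<notin> prefix_sign c A"
  by (auto simp: prefix_sign_def initial_def)

lemma initial_prefix_sign: "s \<in> prefix_sign c A \<Longrightarrow> initial s = Some c"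
  by (auto simp: prefix_sign_def initial_def)

lemma initial_flip: "initial (flip s) = Some c \<longleftrightarrow> initial s = Some (opposite c)"
proof (cases s)
  case (Cons a t)
  then show ?thesis by (cases a; cases c) (simp_all add: initial_def flip_def)
qed (simp add: initial_def flip_def)

lemma length_flip [simp]: "length (flip s) = length s" "flip s = [] \<longleftrightarrow> s = []"
  by (simp_all add: flip_def)

lemma prefix_sign_nonempty: "A \<noteq> {} \<Longrightarrow> prefix_sign c A \<noteq> {}"
  by (auto simp: prefix_sign_def)

text \<open>\<open>bounded_paths Plus k (Alt p)\<close> says that \<open>p\<close> belongs to \<open>E\<^sub>k\<^sup>+\<close>, and with \<open>Minus\<close> to \<open>U\<^sub>k\<^sup>+\<close>.\<close>

definition bounded_paths :: "sign \<Rightarrow> nat \<Rightarrow> path set \<Rightarrow> bool" where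
  "bounded_paths c k A \<longleftrightarrow>
    (\<forall>s \<in> A. length s \<le> k \<and> (s \<noteq> [] \<and> length s = k \<longrightarrow> initial s = Some c))"

lemma bounded_paths_Un:
  "bounded_paths c k (A \<union> B) \<longleftrightarrow> bounded_paths c k A \<and> bounded_paths c k B"
  by (auto simp: bounded_paths_def)

lemma bounded_paths_flip:
  "bounded_paths c k (flip ` A) \<longleftrightarrow> bounded_paths (opposite c) k A"
  by (simp add: bounded_paths_def initial_flip)

text \<open>A path of A that does not begin with c reappears with c in front, so its own length is
  below k; the other paths are in the prefixed set themselves.\<close>

lemma bounded_paths_prefix_same:
  assumes "bounded_paths c k (prefix_sign c A)" shows "bounded_paths c k A"
  unfolding bounded_paths_def
proof
  fix s assume s: "s \<in> A"
  show "length s \<le> k \<and> (s \<noteq> [] \<and> length s = k \<longrightarrow> initial s = Some c)"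
  proof (cases "initial s = Some c")
    case True
    then have "s \<in> prefix_sign c A" using s by (simp add: prefix_sign_def)
    then show ?thesis using assms by (simp add: bounded_paths_def)
  next
    case False
    then have "c # s \<in> prefix_sign c A" using s by (auto simp: prefix_sign_def)
    then have "length (c # s) \<le> k" using assms unfolding bounded_paths_def by blast
    then show ?thesis by simp
  qed
qed

text \<open>Every path of the prefixed set begins with d, while one of length k + 1 would have to
  begin with c. This moves \<forall>x p from E_(k+1)^+ to U_k^+, and dually for \<exists>.\<close>

lemma bounded_paths_prefix_other:
  assumes b: "bounded_paths c (Suc k) (prefix_sign d A)" and "d \<noteq> c"
  shows "bounded_paths d k (prefix_sign d A)"
  unfolding bounded_paths_def
proof
  fix s assume s: "s \<in> prefix_sign d A"
  then have d: "initial s = Some d" by (rule initial_prefix_sign)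
  then have "length s \<noteq> Suc k" using b s \<open>d \<noteq> c\<close> by (auto simp: bounded_paths_def)
  then show "length s \<le> k \<and> (s \<noteq> [] \<and> length s = k \<longrightarrow> initial s = Some d)"
    using b s d by (auto simp: bounded_paths_def le_Suc_eq)
qed

text \<open>A quantified formula has a path, and none of its paths is empty; hence it cannot occur
  at level 0.\<close>

lemma bounded_paths_0_prefix:
  assumes "A \<noteq> {}" shows "\<not> bounded_paths c 0 (prefix_sign d A)"
proof -
  obtain s where "s \<in> prefix_sign d A" using prefix_sign_nonempty[OF assms] by blast
  moreover from this have "s \<noteq> []" using Nil_notin_prefix_sign by blast
  ultimately show ?thesis by (auto simp: bounded_paths_def)
qed

lemma F_class_length: "p \<in> F_class i \<Longrightarrow> s \<in> Alt p \<Longrightarrow> length s \<le> i"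
  by (auto simp: F_class_def degree_def finite_Alt)

lemma E_plus_bounded_paths:
  assumes "p \<in> E_plus k" shows "bounded_paths Plus k (Alt p)"
  unfolding bounded_paths_def
proof
  fix s assume s: "s \<in> Alt p"
  from assms consider (top) "p \<in> E_class k" | (low) i where "i < k" "p \<in> F_class i"
    by (auto simp: E_plus_def)
  then show "length s \<le> k \<and> (s \<noteq> [] \<and> length s = k \<longrightarrow> initial s = Some Plus)"
  proof cases
    case top
    show ?thesis
    proof (cases k)
      case 0
      then show ?thesis using F_class_length[of p 0 s] top s by simp
    next
      case (Suc j)
      then show ?thesis using F_class_length[of p k s] top s by simp
    qed
  next
    case low
    then show ?thesis using F_class_length[OF low(2) s] by simp
  qed
qed

lemma U_plus_bounded_paths:
  assumes "p \<in> U_plus k" shows "bounded_paths Minus k (Alt p)"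
  unfolding bounded_paths_def
proof
  fix s assume s: "s \<in> Alt p"
  from assms consider (top) "p \<in> U_class k" | (low) i where "i < k" "p \<in> F_class i"
    by (auto simp: U_plus_def)
  then show "length s \<le> k \<and> (s \<noteq> [] \<and> length s = k \<longrightarrow> initial s = Some Minus)"
  proof cases
    case top
    show ?thesis
    proof (cases k)
      case 0
      then show ?thesis using F_class_length[of p 0 s] top s by simp
    next
      case (Suc j)
      then show ?thesis using F_class_length[of p k s] top s by simp
    qed
  next
    case low
    then show ?thesis using F_class_length[OF low(2) s] by simp
  qed
qed

section \<open>The prenex normal form theorem\<close>

lemma bounded_paths_Imp:
  assumes "bounded_paths c k (Alt (Imp p q))" "\<not> qfree (Imp p q)"
  shows "bounded_paths (opposite c) k (Alt p)" "bounded_paths c k (Alt q)"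
proof -
  have "bounded_paths (opposite c) k (Alt p) \<and> bounded_paths c k (Alt q)"
  proof (cases "q = Fls")
    case True
    then have "Alt (Imp p q) = flip ` Alt p" using assms(2) by simp
    \<comment> \<open>The clause for negation omits the empty path of \<open>Fls\<close>, but that
      path satisfies every bound.\<close>
    then show ?thesis using assms(1) True by (simp add: bounded_paths_flip) (simp add: bounded_paths_def)
  next
    case False
    then have "Alt (Imp p q) = flip ` Alt p \<union> Alt q" using assms(2) by auto
    then show ?thesis using assms(1) by (simp add: bounded_paths_Un bounded_paths_flip)
  qed
  then show "bounded_paths (opposite c) k (Alt p)" "bounded_paths c k (Alt q)" by blast+
qed

section \<open>Congruence laws up to negation\<close>

lemma imp_Neg_commute:
  assumes "wf_fm p" "wf_fm q"
  shows "equiv_in T (Imp p (Neg q)) (Imp q (Neg p))"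
proof -
  have "deriv T {Imp p (Neg q)} (Imp q (Neg p))" if "wf_fm p" "wf_fm q" for p q
  proof (intro deriv.ImpI)
    let ?G = "{p, q, Imp p (Neg q)}"
    have "deriv T ?G (Neg q)"
      by (rule deriv.ImpE[of _ _ p]; rule deriv.Hyp) (use that in auto)
    then show "deriv T ?G Fls" by (rule deriv.ImpE) (use that in \<open>simp add: deriv.Hyp\<close>)
  qed (use that in simp_all)
  then show ?thesis using assms by (simp add: equiv_in_def)
qed

lemma neg_And_equiv:
  assumes "wf_fm p" "wf_fm q"
  shows "equiv_in T (Neg (And p q)) (Imp p (Neg q))"
proof -
  have "deriv T {Neg (And p q)} (Imp p (Neg q))"
  proof (intro deriv.ImpI)
    show "deriv T {q, p, Neg (And p q)} Fls"
      by (rule deriv.ImpE[of _ _ "And p q"]) (use assms in \<open>simp_all add: deriv_And deriv.Hyp\<close>)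
  qed (use assms in simp_all)
  moreover have "deriv T {Imp p (Neg q)} (Neg (And p q))"
  proof (rule deriv.ImpI)
    let ?G = "{And p q, Imp p (Neg q)}"
    have pq: "deriv T ?G (And p q)" using assms by (simp add: deriv.Hyp)
    have "deriv T ?G (Imp p (Neg q))" using assms by (simp add: deriv.Hyp)
    then show "deriv T ?G Fls" using pq unfolding deriv_And by (meson deriv.ImpE)
  qed (use assms in simp)
  ultimately show ?thesis using assms by (simp add: equiv_in_def)
qed

text \<open>In the form p \<rightarrow> \<not>q only the negation of q occurs, and contraposition
  gives the same for p; so the conjuncts are replaced in turn.\<close>

lemma neg_And_cong:
  assumes "equiv_in T (Neg p) (Neg p')" "equiv_in T (Neg q) (Neg q')"
    "wf_fm p" "wf_fm q" "wf_fm p'" "wf_fm q'"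
  shows "equiv_in T (Neg (And p q)) (Neg (And p' q'))"
proof -
  have "equiv_in T (Neg (And p q)) (Imp p (Neg q))" using assms by (simp add: neg_And_equiv)
  also have "equiv_in T (Imp p (Neg q)) (Imp p (Neg q'))"
    by (rule equiv_in_Imp[OF equiv_in_refl[OF assms(3)] assms(2)])
  also have "equiv_in T (Imp p (Neg q')) (Imp q' (Neg p))" using assms by (simp add: imp_Neg_commute)
  also have "equiv_in T (Imp q' (Neg p)) (Imp q' (Neg p'))"
    by (rule equiv_in_Imp[OF equiv_in_refl[OF assms(6)] assms(1)])
  also have "equiv_in T (Imp q' (Neg p')) (Imp p' (Neg q'))"
    using assms by (simp add: imp_Neg_commute)
  also have "equiv_in T (Imp p' (Neg q')) (Neg (And p' q'))"
    using assms by (intro equiv_in_sym[OF neg_And_equiv])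
  finally show ?thesis .
qed

lemma neg_Imp_equiv:
  assumes "wf_fm p" "wf_fm q"
  shows "equiv_in T (Neg (Imp p q)) (And (Neg (Neg p)) (Neg q))"
proof (rule equiv_inI)
  fix G
  show "deriv T G (Neg (Imp p q)) \<longleftrightarrow> deriv T G (And (Neg (Neg p)) (Neg q))"
  proof
    assume N: "deriv T G (Neg (Imp p q))"
    have "deriv T G (Neg (Neg p))"
    proof (rule deriv.ImpI)
      have "deriv T (insert (Neg p) G) (Imp p q)"
        using assms by (intro deriv_vacuous_Imp[OF _ _ deriv_hyp]) simp_all
      moreover have "deriv T (insert (Neg p) G) (Neg (Imp p q))" by (rule deriv_mono[OF N]) auto
      ultimately show "deriv T (insert (Neg p) G) Fls" by (rule deriv.ImpE[rotated])
    qed (use assms in simp)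
    moreover have "deriv T G (Neg q)"
    proof (rule deriv.ImpI)
      have "deriv T (insert q G) (Imp p q)"
        using assms by (intro deriv.ImpI deriv.Hyp) auto
      moreover have "deriv T (insert q G) (Neg (Imp p q))" by (rule deriv_mono[OF N]) auto
      ultimately show "deriv T (insert q G) Fls" by (rule deriv.ImpE[rotated])
    qed (use assms in simp)
    ultimately show "deriv T G (And (Neg (Neg p)) (Neg q))" by (rule deriv.AndI)
  next
    assume "deriv T G (And (Neg (Neg p)) (Neg q))"
    then have N: "deriv T G (Neg (Neg p))" "deriv T G (Neg q)" by (simp_all add: deriv_And)
    show "deriv T G (Neg (Imp p q))"
    proof (rule deriv.ImpI)
      let ?G = "insert (Imp p q) G"
      have "deriv T (insert p ?G) q"
        by (rule deriv.ImpE[of _ _ p]; rule deriv.Hyp) (use assms in auto)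
      moreover have "deriv T (insert p ?G) (Neg q)" by (rule deriv_mono[OF N(2)]) auto
      ultimately have "deriv T (insert p ?G) Fls" by (rule deriv.ImpE[rotated])
      then have "deriv T ?G (Neg p)" using assms(1) by (rule deriv.ImpI)
      moreover have "deriv T ?G (Neg (Neg p))" by (rule deriv_mono[OF N(1)]) auto
      ultimately show "deriv T ?G Fls" by (rule deriv.ImpE[rotated])
    qed (use assms in simp)
  qed
qed (use assms in simp_all)

lemma equiv_in_Neg: "equiv_in T p q \<Longrightarrow> equiv_in T (Neg p) (Neg q)"
  by (rule equiv_in_Imp[OF _ equiv_in_refl]) simp_all

lemma neg_Imp_cong:
  assumes "equiv_in T p p'" "equiv_in T (Neg q) (Neg q')" "wf_fm q" "wf_fm q'"
  shows "equiv_in T (Neg (Imp p q)) (Neg (Imp p' q'))"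
proof -
  have wf: "wf_fm p" "wf_fm p'" using equiv_in_wf[OF assms(1)] by simp_all
  have "equiv_in T (Neg (Imp p q)) (And (Neg (Neg p)) (Neg q))"
    using wf assms by (intro neg_Imp_equiv) 
  also have "equiv_in T (And (Neg (Neg p)) (Neg q)) (And (Neg (Neg p')) (Neg q'))"
    by (rule equiv_in_And[OF equiv_in_Neg[OF equiv_in_Neg[OF assms(1)]] assms(2)])
  also have "equiv_in T (And (Neg (Neg p')) (Neg q')) (Neg (Imp p' q'))"
    using wf assms by (intro equiv_in_sym[OF neg_Imp_equiv])
  finally show ?thesis .
qed

text \<open>For stable q the implication is equivalent to its contrapositive, in which p occurs only
  negated.\<close>

lemma imp_stable_cong:
  assumes "equiv_in T (Neg p) (Neg p')" "wf_fm p" "wf_fm p'" "stable T q"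
  shows "equiv_in T (Imp p q) (Imp p' q)"
proof -
  have wf: "wf_fm q" using assms by (simp add: stable_def)
  have "equiv_in T (Imp p q) (Imp (Neg q) (Neg p))" if "wf_fm p" for p
  proof -
    have "deriv T G (Imp p q)" if *: "deriv T G (Imp (Neg q) (Neg p))" for G
    proof (rule deriv.ImpI)
      let ?G = "insert (Neg q) (insert p G)"
      have "deriv T ?G (Imp (Neg q) (Neg p))" by (rule deriv_mono[OF *]) auto
      then have "deriv T ?G (Neg p)"
        by (rule deriv.ImpE) (use wf in \<open>simp add: deriv_hyp\<close>)
      then have "deriv T ?G Fls" by (rule deriv.ImpE) (use \<open>wf_fm p\<close> in \<open>simp add: deriv.Hyp\<close>)
      then have "deriv T (insert p G) (Neg (Neg q))" by (rule deriv.ImpI) (use wf in simp)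
      then show "deriv T (insert p G) q" by (rule deriv_stable[OF assms(4)])
    qed (rule \<open>wf_fm p\<close>)
    moreover have "deriv T G (Imp (Neg q) (Neg p))" if "deriv T G (Imp p q)" for G
      using that \<open>wf_fm p\<close> wf by (simp add: deriv_Imp)
    ultimately show ?thesis using wf \<open>wf_fm p\<close> by (intro equiv_inI) auto
  qed
  moreover have "equiv_in T (Imp (Neg q) (Neg p)) (Imp (Neg q) (Neg p'))"
    by (rule equiv_in_Imp[OF equiv_in_refl assms(1)]) (use wf in simp)
  ultimately show ?thesis using assms by (meson equiv_in_sym equiv_in_trans)
qed

lemma neg_Ex_equiv:
  assumes "wf_fm p" shows "equiv_in T (Neg (Ex p)) (All (Neg p))"
  using Ex_imp_step[OF equiv_in_refl, of p Fls T] assms by simp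

text \<open>Intuitionistically \<not>\<exists> is \<forall>\<not>, so the negations of the bodies
  suffice.\<close>

lemma neg_Ex_cong:
  assumes T: "closed_under_subst T" and "equiv_in T (Neg p) (Neg p')" "wf_fm p" "wf_fm p'"
  shows "equiv_in T (Neg (Ex p)) (Neg (Ex p'))"
proof -
  have "equiv_in T (Neg (Ex p)) (All (Neg p))" using assms by (intro neg_Ex_equiv)
  also have "equiv_in T (All (Neg p)) (All (Neg p'))" using assms by (intro equiv_in_All)
  also have "equiv_in T (All (Neg p')) (Neg (Ex p'))"
    using assms by (intro equiv_in_sym[OF neg_Ex_equiv])
  finally show ?thesis .
qed

section \<open>Normal forms, connective by connective\<close>

definition Sigma_normal :: "nat \<Rightarrow> fm \<Rightarrow> fm \<Rightarrow> bool" where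
  "Sigma_normal k p p' \<longleftrightarrow> p' \<in> Sigma_fm k \<and> fv p' = fv p \<and>
    equiv_in (DNE_theory k) (Neg p) (Neg p') \<and> equiv_in (DNE_theory (Suc k)) p p'"

definition Pi_normal :: "nat \<Rightarrow> fm \<Rightarrow> fm \<Rightarrow> bool" where
  "Pi_normal k p p' \<longleftrightarrow> p' \<in> Pi_fm k \<and> fv p' = fv p \<and> equiv_in (DNE_theory k) p p'"

lemma qfree_normal:
  assumes "wf_fm p" "qfree p" shows "Sigma_normal k p p" "Pi_normal k p p"
  using assms by (simp_all add: Sigma_normal_def Pi_normal_def qfree_prenex equiv_in_refl)

text \<open>The full equivalence on the \<Sigma> side is over \<open>DNE_theory (Suc k)\<close>,
  exactly the theory of the \<Pi> side one level up; an empty universal block adjusts the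
  class.\<close>

lemma Sigma_to_Pi_normal:
  "Sigma_normal k p p' \<Longrightarrow> Pi_normal (Suc k) p p'"
  using Sigma_subset_Pi by (auto simp: Sigma_normal_def Pi_normal_def)

lemma Pi_to_Sigma_normal:
  assumes "Pi_normal k p p'" shows "Sigma_normal (Suc k) p p'"
proof -
  have "equiv_in (DNE_theory (Suc k)) p p'"
    using assms equiv_in_mono[OF _ DNE_theory_Suc] by (simp add: Pi_normal_def)
  then show ?thesis
    using assms Pi_subset_Sigma equiv_in_mono[OF _ DNE_theory_Suc]
    by (auto simp: Sigma_normal_def Pi_normal_def intro: equiv_in_Neg)
qed

lemma Sigma_normal_And:
  assumes "Sigma_normal k p p'" "Sigma_normal k q q'"
  shows "\<exists>r. Sigma_normal k (And p q) r"
proof -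
  obtain r where r: "r \<in> Sigma_fm k" "fv r = fv p' \<union> fv q'" "equiv_in HA (And p' q') r"
    using conj_prenex(1)[OF closed_HA] assms unfolding Sigma_normal_def by blast
  have r': "equiv_in (DNE_theory j) (And p' q') r" for j
    by (rule equiv_in_mono[OF r(3) HA_subset_DNE_theory])
  have "equiv_in (DNE_theory k) (Neg (And p q)) (Neg (And p' q'))"
    using assms by (intro neg_And_cong) (auto simp: Sigma_normal_def dest: equiv_in_wf)
  then have "equiv_in (DNE_theory k) (Neg (And p q)) (Neg r)"
    using equiv_in_trans equiv_in_Neg[OF r'] by blast
  moreover have "equiv_in (DNE_theory (Suc k)) (And p q) r"
    using assms equiv_in_trans[OF equiv_in_And r'] by (simp add: Sigma_normal_def)
  ultimately show ?thesis using r assms by (auto simp: Sigma_normal_def)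
qed

lemma Pi_normal_And:
  assumes "Pi_normal k p p'" "Pi_normal k q q'"
  shows "\<exists>r. Pi_normal k (And p q) r"
proof -
  obtain r where r: "r \<in> Pi_fm k" "fv r = fv p' \<union> fv q'" "equiv_in HA (And p' q') r"
    using conj_prenex(2)[OF closed_HA] assms unfolding Pi_normal_def by blast
  have "equiv_in (DNE_theory k) (And p' q') r"
    by (rule equiv_in_mono[OF r(3) HA_subset_DNE_theory])
  moreover have "equiv_in (DNE_theory k) (And p q) (And p' q')"
    using assms by (intro equiv_in_And) (simp_all add: Pi_normal_def)
  ultimately have "equiv_in (DNE_theory k) (And p q) r" by (rule equiv_in_trans[rotated])
  then show ?thesis using r assms by (auto simp: Pi_normal_def)
qed

text \<open>Over \<open>DNE_theory k\<close> the prenexing is only weak, which is still enough for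
  the negations; over \<open>DNE_theory (Suc k)\<close> its result is stable and the equivalence is
  full.\<close>

lemma Sigma_normal_Imp:
  assumes "Pi_normal k p p'" "Sigma_normal k q q'"
  shows "\<exists>r. Sigma_normal k (Imp p q) r"
proof -
  obtain r where r: "r \<in> Sigma_fm k" "fv r = fv p' \<union> fv q'"
    "weakly_equiv (DNE_theory k) (Imp p' q') r"
    using imp_prenex(1) assms unfolding Sigma_normal_def Pi_normal_def by blast
  have wf: "wf_fm q" "wf_fm q'" using assms by (auto simp: Sigma_normal_def dest: equiv_in_wf)
  have "equiv_in (DNE_theory k) (Neg (Imp p q)) (Neg (Imp p' q'))"
    using assms wf by (intro neg_Imp_cong) (simp_all add: Sigma_normal_def Pi_normal_def)
  also have "equiv_in (DNE_theory k) (Neg (Imp p' q')) (Neg r)"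
  proof -
    have "deriv (DNE_theory k) {Neg (Imp p' q')} (Neg r)"
    proof (rule deriv.ImpI)
      let ?G = "{r, Neg (Imp p' q')}"
      have "deriv (DNE_theory k) ?G (Imp p' q')"
        by (rule deriv_mono[of _ "{r}"]) (use r(3) in \<open>simp_all add: weakly_equiv_def\<close>)
      moreover have "deriv (DNE_theory k) ?G (Neg (Imp p' q'))"
        using r(3) by (intro deriv.Hyp) (auto simp: weakly_equiv_def)
      ultimately show "deriv (DNE_theory k) ?G Fls" by (rule deriv.ImpE[rotated])
    qed (use r(3) in \<open>simp add: weakly_equiv_def\<close>)
    then show ?thesis using r(3) by (simp add: weakly_equiv_def equiv_in_def)
  qed
  finally have 1: "equiv_in (DNE_theory k) (Neg (Imp p q)) (Neg r)" .
  have "equiv_in (DNE_theory (Suc k)) (Imp p q) (Imp p' q')"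
    using assms equiv_in_mono[OF _ DNE_theory_Suc]
    by (intro equiv_in_Imp) (simp_all add: Sigma_normal_def Pi_normal_def)
  also have "equiv_in (DNE_theory (Suc k)) (Imp p' q') r"
  proof (rule weakly_equiv_stable[OF _ stable_Sigma[OF r(1)]])
    show "weakly_equiv (DNE_theory (Suc k)) (Imp p' q') r"
      using r(3) deriv_mono_axioms[OF _ DNE_theory_Suc] by (simp add: weakly_equiv_def)
  qed
  finally show ?thesis using 1 r assms by (auto simp: Sigma_normal_def Pi_normal_def)
qed

lemma Pi_normal_Imp:
  assumes "Sigma_normal k p p'" "Pi_normal k q q'"
  shows "\<exists>r. Pi_normal k (Imp p q) r"
proof -
  obtain r where r: "r \<in> Pi_fm k" "fv r = fv p' \<union> fv q'" "equiv_in (DNE_theory k) (Imp p' q') r"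
    using imp_prenex(2) assms unfolding Sigma_normal_def Pi_normal_def by blast
  have wf: "wf_fm p" "wf_fm p'" using assms by (auto simp: Sigma_normal_def dest: equiv_in_wf)
  have q: "equiv_in (DNE_theory k) q q'" "stable (DNE_theory k) q'"
    using assms stable_Pi by (simp_all add: Pi_normal_def)
  have "equiv_in (DNE_theory k) (Imp p q) (Imp p q')"
    by (rule equiv_in_Imp[OF equiv_in_refl[OF wf(1)] q(1)])
  \<comment> \<open>Over this theory only the negations of p and p' are known to be equivalent;
    stability of the \<Pi>_k formula q' makes that enough.\<close>
  also have "equiv_in (DNE_theory k) (Imp p q') (Imp p' q')"
    by (rule imp_stable_cong) (use assms wf q in \<open>simp_all add: Sigma_normal_def\<close>)
  also note r(3)
  finally show ?thesis using r assms by (auto simp: Sigma_normal_def Pi_normal_def)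
qed

lemma Sigma_normal_Ex:
  assumes "Sigma_normal (Suc k) p p'" shows "Sigma_normal (Suc k) (Ex p) (Ex p')"
proof -
  have e: "equiv_in (DNE_theory (Suc k)) (Neg p) (Neg p')"
    "equiv_in (DNE_theory (Suc (Suc k))) p p'"
    using assms by (simp_all add: Sigma_normal_def)
  have "wf_fm p" "wf_fm p'" using equiv_in_wf[OF e(2)] by simp_all
  then show ?thesis
    using assms neg_Ex_cong[OF closed_DNE_theory e(1)] equiv_in_Ex[OF e(2)] Ex_in_Sigma
    by (simp add: Sigma_normal_def)
qed

lemma Pi_normal_All:
  assumes "Pi_normal (Suc k) p p'" shows "Pi_normal (Suc k) (All p) (All p')"
  using assms equiv_in_All[OF closed_DNE_theory] All_in_Pi by (simp add: Pi_normal_def)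

text \<open>Implication exchanges the two statements at the same level, hence the conjunction; a
  quantifier of the wrong sign lowers the level, hence the arbitrary k.\<close>

lemma prenex_normal_form:
  assumes "wf_fm p" "\<not> has_disj p"
  shows "(bounded_paths Plus k (Alt p) \<longrightarrow> (\<exists>p'. Sigma_normal k p p')) \<and>
         (bounded_paths Minus k (Alt p) \<longrightarrow> (\<exists>p'. Pi_normal k p p'))"
  using assms
proof (induction p arbitrary: k)
  case (And p q)
  show ?case
  proof (cases "qfree (And p q)")
    case True
    then show ?thesis using qfree_normal And.prems by blast
  next
    case False
    then have "Alt (And p q) = Alt p \<union> Alt q" by auto
    then show ?thesis
      using And.IH(1)[of k] And.IH(2)[of k] And.prems Sigma_normal_And Pi_normal_And
      by (simp add: bounded_paths_Un) blast
  qed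
next
  case (Imp p q)
  show ?case
  proof (cases "qfree (Imp p q)")
    case True
    then show ?thesis using qfree_normal Imp.prems by blast
  next
    case False
    have IH: "bounded_paths Plus k (Alt p) \<Longrightarrow> \<exists>p'. Sigma_normal k p p'"
      "bounded_paths Minus k (Alt p) \<Longrightarrow> \<exists>p'. Pi_normal k p p'"
      "bounded_paths Plus k (Alt q) \<Longrightarrow> \<exists>q'. Sigma_normal k q q'"
      "bounded_paths Minus k (Alt q) \<Longrightarrow> \<exists>q'. Pi_normal k q q'"
      using Imp by simp_all
    show ?thesis
      using bounded_paths_Imp[OF _ False] IH Sigma_normal_Imp Pi_normal_Imp opposite.simps by metis
  qed
next
  case (All p)
  \<comment> \<open>Stated for every level because the \<Sigma> half below uses it one level
    down.\<close>
  have Pi: "\<exists>p'. Pi_normal k (All p) p'" if b: "bounded_paths Minus k (Alt (All p))" for k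
  proof (cases k)
    case 0
    then show ?thesis using b bounded_paths_0_prefix[OF Alt_nonempty] by simp
  next
    case (Suc j)
    have "bounded_paths Minus k (Alt p)" using b by (simp add: bounded_paths_prefix_same)
    then show ?thesis using All.IH[of k] All.prems Pi_normal_All Suc by auto
  qed
  have "\<exists>p'. Sigma_normal k (All p) p'" if b: "bounded_paths Plus k (Alt (All p))"
  proof (cases k)
    case 0
    then show ?thesis using b bounded_paths_0_prefix[OF Alt_nonempty] by simp
  next
    case (Suc j)
    then have "bounded_paths Minus j (Alt (All p))" using b by (simp add: bounded_paths_prefix_other)
    then show ?thesis using Pi Pi_to_Sigma_normal Suc by blast
  qed
  then show ?case using Pi by blast
next
  case (Ex p)
  have Sigma: "\<exists>p'. Sigma_normal k (Ex p) p'" if b: "bounded_paths Plus k (Alt (Ex p))" for k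
  proof (cases k)
    case 0
    then show ?thesis using b bounded_paths_0_prefix[OF Alt_nonempty] by simp
  next
    case (Suc j)
    have "bounded_paths Plus k (Alt p)" using b by (simp add: bounded_paths_prefix_same)
    then show ?thesis using Ex.IH[of k] Ex.prems Sigma_normal_Ex Suc by auto
  qed
  have "\<exists>p'. Pi_normal k (Ex p) p'" if b: "bounded_paths Minus k (Alt (Ex p))"
  proof (cases k)
    case 0
    then show ?thesis using b bounded_paths_0_prefix[OF Alt_nonempty] by simp
  next
    case (Suc j)
    then have "bounded_paths Plus j (Alt (Ex p))" using b by (simp add: bounded_paths_prefix_other)
    then show ?thesis using Sigma Sigma_to_Pi_normal Suc by blast
  qed
  then show ?case using Sigma by blast
next
  case (Eq s t)
  then show ?case using qfree_normal[of "Eq s t" k] by auto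
next
  case Fls
  then show ?case using qfree_normal[of Fls k] by auto
next
  case (Or p q)
  then show ?case by simp
qed

theorem theorem5p7:
  fixes k :: nat and \<phi> :: fm
  assumes "wf_fm \<phi>" and "\<not> has_disj \<phi>"
  shows "(\<phi> \<in> E_plus k \<longrightarrow>
            (\<exists>\<phi>' \<in> Sigma_fm k. fv \<phi> = fv \<phi>' \<and> HA \<union> DNE (Sigma_fm k) \<turnstile> Iff \<phi> \<phi>')) \<and>
         (\<phi> \<in> U_plus k \<longrightarrow>
            (\<exists>\<phi>' \<in> Pi_fm k. fv \<phi> = fv \<phi>' \<and>
               (if k = 0 then HA else HA \<union> DNE (Sigma_fm (k - 1))) \<turnstile> Iff \<phi> \<phi>'))"
proof (intro conjI impI)
  assume "\<phi> \<in> E_plus k"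
  then obtain \<phi>' where "Sigma_normal k \<phi> \<phi>'"
    using prenex_normal_form[OF assms] E_plus_bounded_paths by blast
  then show "\<exists>\<phi>' \<in> Sigma_fm k. fv \<phi> = fv \<phi>' \<and> HA \<union> DNE (Sigma_fm k) \<turnstile> Iff \<phi> \<phi>'"
    using equiv_in_Iff unfolding Sigma_normal_def DNE_theory_simps by metis
next
  assume "\<phi> \<in> U_plus k"
  then obtain \<phi>' where "Pi_normal k \<phi> \<phi>'"
    using prenex_normal_form[OF assms] U_plus_bounded_paths by blast
  then show "\<exists>\<phi>' \<in> Pi_fm k. fv \<phi> = fv \<phi>' \<and>
      (if k = 0 then HA else HA \<union> DNE (Sigma_fm (k - 1))) \<turnstile> Iff \<phi> \<phi>'"
    using equiv_in_Iff unfolding Pi_normal_def DNE_theory_def by metis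
qed

end
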